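(* Let $G=(V,E)$ be a graph with $n$ vertices, $m$ edges and maximum degree $d$. For any $\epsilon\in(0,1]$, let $\tilde m=n/\epsilon^2$. Then there exists a subset of edges $F\subseteq E$ with $|F|\le8n/\epsilon^2$ such that \[-8\sqrt2\,\epsilon\, d\, I_n\preceq L_G-\frac{m}{\tilde m}\sum_{e\in F}b_eb_e^T\preceq8\sqrt2\,\epsilon\, d\, I_n.\]
   Context: For $e=uv$, $b_e=\chi_u-\chi_v\in\mathbb{R}^n$; $L_G=\sum_{e\in E}b_eb_e^T$ is the Laplacian of $G$; $\preceq$ is the positive semidefinite order.
   Formalization: The formal theorem assumes in addition m ≥ m̃ = n/ε²; without it the claim fails, e.g. for G = K₂ and ε = 1/100, and for m < m̃ it holds only when F = E (nothing removed) already works. *)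

theory Defs
  imports "HOL-Analysis.Analysis"
begin

text \<open>
  A finite simple graph has as its vertices all the elements of a finite type and is given by its
  set of edges, each an unordered pair of distinct vertices. The number of vertices is
  \<^term>\<open>CARD('v::finite)\<close>, and matrices are indexed by the vertices.
\<close>

definition simple_graph :: "'v::finite set set \<Rightarrow> bool" where
  "simple_graph E \<longleftrightarrow> (\<forall>e\<in>E. \<exists>u v. u \<noteq> v \<and> e = {u, v})"

definition degree :: "'v::finite set set \<Rightarrow> 'v \<Rightarrow> nat" where
  "degree E v = card {e \<in> E. v \<in> e}"

definition max_degree :: "'v::finite set set \<Rightarrow> nat" where
  "max_degree E = Max (range (degree E))"

text \<open>
  For an edge \<open>e = uv\<close> the vector \<open>b\<^sub>e = \<chi>\<^sub>u - \<chi>\<^sub>v\<close> depends, up to sign, on the order of the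
  endpoints, so an order is chosen arbitrarily. The matrix \<open>b\<^sub>e b\<^sub>e\<^sup>T\<close> does not
  depend on this choice, see \<open>edge_matrix_doubleton\<close> below.
\<close>

definition edge_vec :: "'v::finite set \<Rightarrow> real ^ 'v" where
  "edge_vec e = (let p = (SOME p. e = {fst p, snd p}) in axis (fst p) 1 - axis (snd p) 1)"

definition outer :: "real ^ 'v \<Rightarrow> real ^ 'v ^ 'v" where
  "outer b = (\<chi> i j. b $ i * b $ j)"

definition edge_matrix :: "'v::finite set \<Rightarrow> real ^ 'v ^ 'v" where
  "edge_matrix e = outer (edge_vec e)"

lemma edge_matrix_doubleton:
  "edge_matrix {u, v} = outer (axis u 1 - axis v 1)"
proof -
  define p where "p = (SOME p. {u, v} = {fst p, snd p})"
  have "{u, v} = {fst p, snd p}"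
    unfolding p_def by (rule someI[of _ "(u, v)"]) simp
  then have "fst p = u \<and> snd p = v \<or> fst p = v \<and> snd p = u"
    by (auto simp: doubleton_eq_iff)
  moreover have "edge_vec {u, v} = axis (fst p) 1 - axis (snd p) 1"
    by (simp add: edge_vec_def p_def Let_def)
  ultimately have "edge_vec {u, v} = axis u 1 - axis v 1 \<or>
      edge_vec {u, v} = - (axis u 1 - axis v 1)"
    by auto
  then show ?thesis
    by (auto simp only: edge_matrix_def outer_def vector_uminus_component minus_mult_minus)
qed

definition laplacian :: "'v::finite set set \<Rightarrow> real ^ 'v ^ 'v" where
  "laplacian E = (\<Sum>e\<in>E. edge_matrix e)"

definition psd :: "real ^ 'v::finite ^ 'v \<Rightarrow> bool" where
  "psd A \<longleftrightarrow> transpose A = A \<and> (\<forall>x. 0 \<le> x \<bullet> (A *v x))"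

definition psd_le :: "real ^ 'v::finite ^ 'v \<Rightarrow> real ^ 'v ^ 'v \<Rightarrow> bool" (infix "\<preceq>" 50) where
  "A \<preceq> B \<longleftrightarrow> psd (B - A)"

end

theory Submission
  imports Defs "HOL-Computational_Algebra.Fundamental_Theorem_Algebra"
begin

text \<open>
  Keep each edge independently with probability \<open>1 / s\<close>, where \<open>s = m / m'\<close>. The error is
  \<open>\<Sum> \<xi>\<^sub>e b\<^sub>e b\<^sub>e\<^sup>T\<close> with independent centred weights \<open>\<xi>\<^sub>e \<in> {s - 1, - 1}\<close>, and the existence of
  a good outcome follows by the method of interlacing polynomials, in the form given to it by Kyng,
  Luh and Song. The expected polynomial \<open>E det (x + A\<^sub>\<xi>) det (x - A\<^sub>\<xi>)\<close> and all its conditional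
  versions are real rooted, so some outcome has no root beyond the largest root of the expectation.
  The latter is bounded by a barrier argument: averaging over \<open>\<xi>\<^sub>e\<close> is the operator
  \<open>1 - (s - 1) \<partial>\<^sup>2 / 2\<close> in the direction \<open>b\<^sub>e b\<^sub>e\<^sup>T\<close>, and compared with a shift by
  \<open>- \<delta>\<^sub>e b\<^sub>e b\<^sub>e\<^sup>T\<close> it decreases all logarithmic derivatives in positive semidefinite rank-one
  directions, provided that \<open>\<delta>\<^sub>e\<^sup>2 \<le> s - 1\<close> and that the logarithmic derivative in the
  direction \<open>b\<^sub>e b\<^sub>e\<^sup>T\<close> is at most \<open>\<delta>\<^sub>e / (s - 1)\<close>.
\<close>

section \<open>Expected products of determinants under rank-one updates\<close>

text \<open>One factor alone would give a one-sided and hence empty conclusion: giving every edge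
  the weight -1 bounds the error from above by 0. The product has the roots +-lambda for the
  eigenvalues lambda of the error, so its largest root bounds the spectrum on both sides. It also
  makes the first-order terms in each weight cancel, and only the variance \<open>s - 1\<close> is
  left.

  A determinant is affine in a rank-one update, so each barrier step concerns quadratic polynomials
  only. Stability enters that step solely through the Rayleigh and Laguerre inequalities for their
  coefficients, and the control of logarithmic derivatives is stated in integrated form, as a
  comparison of values with the square of one determinant.

  The constant 3 in the general bound is 1 + 2: the shifts use up \<open>sqrt V\<close>, and
  \<open>2 * sqrt V\<close> has to remain to keep the logarithmic derivatives small. For the graph
  \<open>V = 16 * s * d\<close>, so the error is \<open>12 * sqrt (s * d)\<close>, and
  \<open>2 * m \<le> n * d\<close> turns this into at most
  \<open>6 * sqrt 2 * \<epsilon> * d\<close>. The assumption \<open>m' \<le> m\<close> says that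
  \<open>1 / s\<close> is a probability.\<close>

definition rank1_update :: "'a::real_field^'n^'n \<Rightarrow> 'a \<Rightarrow> real^'n \<Rightarrow> 'a^'n^'n" where
  "rank1_update A t u = (\<chi> i j. A $ i $ j + t * of_real (u $ i * u $ j))"

lemma rank1_update_nth [simp]:
  "rank1_update A t u $ i $ j = A $ i $ j + t * of_real (u $ i * u $ j)"
  by (simp add: rank1_update_def)

lemma rank1_update_0 [simp]: "rank1_update A 0 u = A"
  by (simp add: vec_eq_iff)

lemma rank1_update_rank1_update [simp]:
  "rank1_update (rank1_update A s u) t u = rank1_update A (s + t) u"
  by (simp add: vec_eq_iff algebra_simps)

lemma rank1_update_commute:
  "rank1_update (rank1_update A s v) t u = rank1_update (rank1_update A t u) s v"
  by (simp add: vec_eq_iff algebra_simps)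

text \<open>Row \<open>k\<close> is never changed, so the other rows can be treated one at a time;
  the induction runs over the set \<open>S\<close> of rows already treated.\<close>

lemma det_row_operations:
  fixes B :: "'a::comm_ring_1^'n^'n"
  shows "det (\<chi> i. if i = k then B $ k else B $ i + c i *s B $ k) = det B"
proof -
  have "finite S \<Longrightarrow> k \<notin> S \<Longrightarrow>
    det (\<chi> i. if i \<in> S then B $ i + c i *s B $ k else B $ i) = det B" for S
  proof (induction S rule: finite_induct)
    case (insert j S)
    let ?M = "(\<chi> i. if i \<in> S then B $ i + c i *s B $ k else B $ i)"
    have "det (\<chi> l. if l = j then row j ?M + c j *s row k ?M else row l ?M) = det ?M"
      using insert by (intro det_row_operation) auto
    moreover have "(\<chi> l. if l = j then row j ?M + c j *s row k ?M else row l ?M)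
        = (\<chi> i. if i \<in> insert j S then B $ i + c i *s B $ k else B $ i)"
      using insert by (auto simp: vec_eq_iff row_def)
    ultimately show ?case
      using insert by simp
  qed simp
  from this[of "- {k}"]
  have "det (\<chi> i. if i \<in> - {k} then B $ i + c i *s B $ k else B $ i) = det B"
    by simp
  moreover have "(\<chi> i. if i \<in> - {k} then B $ i + c i *s B $ k else B $ i)
      = (\<chi> i. if i = k then B $ k else B $ i + c i *s B $ k)"
    by (auto simp: vec_eq_iff)
  ultimately show ?thesis
    by simp
qed

text \<open>Row operations confine the update to a single row.\<close>

lemma det_rank1_update:
  "det (rank1_update A t u) = det A + t * (det (rank1_update A 1 u) - det A)"
proof (cases "u = 0")
  case True
  then show ?thesis
    by (simp add: rank1_update_def)
next
  case False
  then obtain k where k: "u $ k \<noteq> 0"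
    by (metis vec_eq_iff zero_index)
  define w :: "'a^'b" where "w = (\<chi> j. of_real (u $ j))"
  define c :: "'b \<Rightarrow> 'a" where "c i = of_real (u $ i / u $ k)" for i
  define B where "B s = (\<chi> i. if i = k then A $ k + s *s (of_real (u $ k) *s w)
      else A $ i - c i *s A $ k)" for s
  have det_B: "det (rank1_update A s u) = det (B s)" for s
  proof -
    have "rank1_update A s u = (\<chi> i. if i = k then B s $ k else B s $ i + c i *s B s $ k)"
      using k by (auto simp: vec_eq_iff B_def w_def c_def algebra_simps)
    then show ?thesis
      using det_row_operations[of k "B s" c] by simp
  qed
  define X Y where "X = det (\<chi> i. if i = k then A $ k else A $ i - c i *s A $ k)"
    and "Y = det (\<chi> i. if i = k then of_real (u $ k) *s w else A $ i - c i *s A $ k)"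
  have "det (B s) = X + s * Y" for s
    using det_row_add[of k "\<lambda>i. A $ k" "\<lambda>i. s *s (of_real (u $ k) *s w)" "\<lambda>i. A $ i - c i *s A $ k"]
      det_row_mul[of k s "\<lambda>i. of_real (u $ k) *s w" "\<lambda>i. A $ i - c i *s A $ k"]
    unfolding B_def X_def Y_def by simp
  then have "det (rank1_update A s u) = X + s * Y" for s
    using det_B by simp
  from this[of t] this[of 0] this[of 1] show ?thesis
    by simp
qed

text \<open>The expectation of \<open>det (A + \<Sum> \<xi>\<^sub>u u u\<^sup>T) det (B - \<Sum> \<xi>\<^sub>u u u\<^sup>T)\<close> for independent \<open>\<xi>\<^sub>u\<close> that
  are \<^term>\<open>r - 1\<close> with probability \<^term>\<open>1 / r\<close> and \<^term>\<open>- 1\<close> otherwise.\<close>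

fun mixed_det :: "real \<Rightarrow> (real^'n) list \<Rightarrow> 'a::real_field^'n^'n \<Rightarrow> 'a^'n^'n \<Rightarrow> 'a" where
  "mixed_det r [] A B = det A * det B"
| "mixed_det r (u # us) A B =
     of_real (1 / r) * mixed_det r us (rank1_update A (of_real (r - 1)) u)
       (rank1_update B (- of_real (r - 1)) u)
     + of_real (1 - 1 / r) * mixed_det r us (rank1_update A (- 1) u) (rank1_update B 1 u)"

text \<open>Rank-one updates commute, so an update of the argument passes through the recursion down
  to \<open>det\<close>, which is affine in it. The slope is written as a difference of two values,
  a form that averaging preserves.\<close>

lemma mixed_det_update_left:
  "mixed_det r us (rank1_update A t u) B =
     mixed_det r us A B + t * (mixed_det r us (rank1_update A 1 u) B - mixed_det r us A B)"
proof (induction us arbitrary: A B)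
  case Nil
  then show ?case
    by (simp add: det_rank1_update[of A t u] algebra_simps)
next
  case (Cons v us)
  have "mixed_det r us (rank1_update (rank1_update A t u) x v) C =
     mixed_det r us (rank1_update A x v) C
       + t * (mixed_det r us (rank1_update (rank1_update A 1 u) x v) C
              - mixed_det r us (rank1_update A x v) C)" for x C
    using Cons.IH[of "rank1_update A x v" C] by (simp only: rank1_update_commute[of A x])
  note IH = this
  show ?case
    by (simp only: mixed_det.simps IH[of "of_real (r - 1)"] IH[of "- 1"]) (simp add: algebra_simps)
qed

lemma mixed_det_update_right:
  "mixed_det r us A (rank1_update B t u) =
     mixed_det r us A B + t * (mixed_det r us A (rank1_update B 1 u) - mixed_det r us A B)"
proof (induction us arbitrary: A B)
  case Nil
  then show ?case
    by (simp add: det_rank1_update[of B t u] algebra_simps)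
next
  case (Cons v us)
  have "mixed_det r us C (rank1_update (rank1_update B t u) x v) =
     mixed_det r us C (rank1_update B x v)
       + t * (mixed_det r us C (rank1_update (rank1_update B 1 u) x v)
              - mixed_det r us C (rank1_update B x v))" for x C
    using Cons.IH[of C "rank1_update B x v"] by (simp only: rank1_update_commute[of B x])
  note IH = this
  show ?case
    by (simp only: mixed_det.simps IH[of _ "- of_real (r - 1)"] IH[of _ 1]) (simp add: algebra_simps)
qed

lemma mixed_det_biaffine:
  obtains \<alpha> \<beta> \<gamma> \<kappa> where
    "\<And>s t. mixed_det r us (rank1_update A s u) (rank1_update B t u) = \<alpha> + \<beta> * s + \<gamma> * t + \<kappa> * s * t"
proof -
  let ?f = "\<lambda>A B. mixed_det r us A B"
  let ?A = "rank1_update A 1 u" and ?B = "rank1_update B 1 u"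
  show thesis
  proof (rule that[of "?f A B" "?f ?A B - ?f A B" "?f A ?B - ?f A B"
        "?f ?A ?B - ?f ?A B - ?f A ?B + ?f A B"])
    fix s t
    have "?f (rank1_update A s u) (rank1_update B t u) =
      ?f (rank1_update A s u) B + t * (?f (rank1_update A s u) ?B - ?f (rank1_update A s u) B)"
      by (rule mixed_det_update_right)
    also have "\<dots> = (?f A B + s * (?f ?A B - ?f A B)) +
       t * ((?f A ?B + s * (?f ?A ?B - ?f A ?B)) - (?f A B + s * (?f ?A B - ?f A B)))"
      using mixed_det_update_left[of r us A s u B] mixed_det_update_left[of r us A s u ?B] by presburger
    finally show "?f (rank1_update A s u) (rank1_update B t u) = ?f A B + (?f ?A B - ?f A B) * s
      + (?f A ?B - ?f A B) * t + (?f ?A ?B - ?f ?A B - ?f A ?B + ?f A B) * s * t"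
      by (simp add: algebra_simps)
  qed
qed

section \<open>Stability\<close>

lemma complex_quadratic_factor:
  fixes \<alpha> \<beta> \<kappa> :: complex
  assumes "\<kappa> \<noteq> 0"
  obtains r q where "\<And>t. \<alpha> + \<beta> * t + \<kappa> * t\<^sup>2 = \<kappa> * (t - r) * (t - q)"
proof -
  define D where "D = csqrt (\<beta>\<^sup>2 - 4 * \<kappa> * \<alpha>)"
  define r where "r = (- \<beta> + D) / (2 * \<kappa>)"
  define q where "q = (- \<beta> - D) / (2 * \<kappa>)"
  have D: "D\<^sup>2 = \<beta>\<^sup>2 - 4 * \<kappa> * \<alpha>"
    by (simp add: D_def)
  have sum: "\<kappa> * (r + q) = - \<beta>"
    using assms by (simp add: r_def q_def field_simps)
  have "4 * \<kappa> * (\<kappa> * (r * q)) = (- \<beta> + D) * (- \<beta> - D)"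
    using assms by (simp add: r_def q_def field_simps)
  also have "\<dots> = 4 * \<kappa> * \<alpha>"
    using D by (simp add: algebra_simps power2_eq_square)
  finally have prod: "\<kappa> * (r * q) = \<alpha>"
    using assms by simp
  have "\<alpha> + \<beta> * t + \<kappa> * t\<^sup>2 = \<kappa> * (t - r) * (t - q)" for t
  proof -
    have "\<kappa> * (t - r) * (t - q) = \<kappa> * t\<^sup>2 - (\<kappa> * (r + q)) * t + \<kappa> * (r * q)"
      by (simp add: algebra_simps power2_eq_square)
    then show ?thesis
      using sum prod by simp
  qed
  then show thesis
    by (rule that)
qed

text \<open>The product of two numbers in the open lower half plane is never a nonnegative real.\<close>

lemma stable_quadratic_minus:
  fixes \<alpha> \<beta> \<kappa> :: complex
  assumes nz: "\<And>t. 0 \<le> Im t \<Longrightarrow> \<alpha> + \<beta> * t + \<kappa> * t\<^sup>2 \<noteq> 0" and v: "0 \<le> v"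
  shows "\<alpha> - of_real v * \<kappa> \<noteq> 0"
proof (cases "\<kappa> = 0")
  case True
  then show ?thesis
    using nz[of 0] by simp
next
  case False
  then obtain r q where rq: "\<And>t. \<alpha> + \<beta> * t + \<kappa> * t\<^sup>2 = \<kappa> * (t - r) * (t - q)"
    using complex_quadratic_factor by metis
  have r: "Im r < 0" and q: "Im q < 0"
    using rq[of r] rq[of q] nz[of r] nz[of q] by force+
  show ?thesis
  proof
    assume "\<alpha> - of_real v * \<kappa> = 0"
    with rq[of 0] have "\<kappa> * (r * q) = \<kappa> * of_real v"
      by (simp add: algebra_simps)
    with False have "r * q = of_real v"
      by simp
    then have "Re r * Im q + Im r * Re q = 0" "Re r * Re q - Im r * Im q = v"
      by (auto simp: complex_eq_iff)
    \<comment> \<open>This is the imaginary part of \<open>r * q * cnj q = v * cnj q\<close>. Its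
      left side is negative and its right side is not.\<close>
    then have "Im r * ((Re q)\<^sup>2 + (Im q)\<^sup>2) = - (v * Im q)"
      by algebra
    moreover have "Im r * ((Re q)\<^sup>2 + (Im q)\<^sup>2) < 0"
      using r q by (intro mult_neg_pos) (simp_all add: sum_power2_gt_zero_iff)
    moreover have "v * Im q \<le> 0"
      using v q by (simp add: mult_nonneg_nonpos)
    ultimately show False
      by simp
  qed
qed

text \<open>The logarithmic derivative is the sum of \<open>1 / (t - r)\<close> over the roots
  \<open>r\<close>, and each summand has negative imaginary part because \<open>r\<close> lies below
  \<open>t\<close>. Multiplying by the conjugate instead of dividing keeps the bound meaningful in
  limits where the polynomial itself may vanish.\<close>

lemma Im_deriv_times_cnj_le:
  fixes \<alpha> \<beta> \<kappa> :: complex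
  assumes nz: "\<And>t. 0 \<le> Im t \<Longrightarrow> \<alpha> + \<beta> * t + \<kappa> * t\<^sup>2 \<noteq> 0" and t: "0 \<le> Im t"
  shows "Im ((\<beta> + 2 * \<kappa> * t) * cnj (\<alpha> + \<beta> * t + \<kappa> * t\<^sup>2)) \<le> 0"
proof (cases "\<kappa> = 0")
  case True
  show ?thesis
  proof (cases "\<beta> = 0")
    case False
    define r where "r = - \<alpha> / \<beta>"
    have \<alpha>: "\<alpha> = - \<beta> * r"
      using False by (simp add: r_def)
    have "Im r < 0"
      using nz[of r] \<open>\<kappa> = 0\<close> \<alpha> by force
    have "(\<beta> + 2 * \<kappa> * t) * cnj (\<alpha> + \<beta> * t + \<kappa> * t\<^sup>2) = (\<beta> * cnj \<beta>) * cnj (t - r)"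
      using \<open>\<kappa> = 0\<close> by (simp add: \<alpha> algebra_simps)
    also have "Im \<dots> = - ((cmod \<beta>)\<^sup>2 * (Im t - Im r))"
      by (simp add: complex_norm_square[symmetric] algebra_simps del: of_real_power)
    finally show ?thesis
      using t \<open>Im r < 0\<close> by simp
  qed (simp add: True)
next
  case False
  then obtain r q where rq: "\<And>t. \<alpha> + \<beta> * t + \<kappa> * t\<^sup>2 = \<kappa> * (t - r) * (t - q)"
    using complex_quadratic_factor by metis
  have r: "Im r < 0" and q: "Im q < 0"
    using rq[of r] rq[of q] nz[of r] nz[of q] by force+
  have "\<beta> = - \<kappa> * (r + q)"
    using rq[of 1] rq[of "-1"] by (simp add: algebra_simps) algebra
  then have d: "\<beta> + 2 * \<kappa> * t = \<kappa> * ((t - r) + (t - q))"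
    by algebra
  have "(\<beta> + 2 * \<kappa> * t) * cnj (\<alpha> + \<beta> * t + \<kappa> * t\<^sup>2)
      = (\<kappa> * cnj \<kappa>) * ((t - r) * cnj (t - r) * cnj (t - q) + (t - q) * cnj (t - q) * cnj (t - r))"
    unfolding rq d by (simp add: algebra_simps)
  also have "Im \<dots> = - ((cmod \<kappa>)\<^sup>2 * ((cmod (t - r))\<^sup>2 * (Im t - Im q) + (cmod (t - q))\<^sup>2 * (Im t - Im r)))"
    unfolding complex_norm_square[symmetric]
    by (simp del: of_real_power) (simp add: algebra_simps)
  finally show ?thesis
    using t r q by (simp add: add_nonneg_nonneg)
qed

text \<open>The test vectors are real even when the entries are complex: the imaginary part of the
  form is then the form of the imaginary part of the matrix, whose definiteness
  \<open>pos_imag\<close> requires.\<close>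

definition quad_form :: "'a::real_field^'n^'n \<Rightarrow> real^'n \<Rightarrow> 'a" where
  "quad_form A p = (\<Sum>i\<in>UNIV. \<Sum>j\<in>UNIV. A $ i $ j * of_real (p $ i * p $ j))"

lemma quad_form_rank1_update:
  "quad_form (rank1_update A t u) p = quad_form A p + t * of_real ((u \<bullet> p)\<^sup>2)"
proof -
  have "(u \<bullet> p)\<^sup>2 = (\<Sum>i\<in>UNIV. \<Sum>j\<in>UNIV. u $ i * u $ j * (p $ i * p $ j))"
    unfolding power2_eq_square inner_vec_def sum_product inner_real_def
    by (intro sum.cong refl) (rule mult.assoc[THEN trans], simp only: mult_ac)
  then have eq: "of_real ((u \<bullet> p)\<^sup>2) = (\<Sum>i\<in>UNIV. \<Sum>j\<in>UNIV. of_real (u $ i * u $ j) * of_real (p $ i * p $ j) :: 'a)"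
    by (simp only: of_real_sum of_real_mult)
  have "quad_form (rank1_update A t u) p = (\<Sum>i\<in>UNIV. \<Sum>j\<in>UNIV.
      A $ i $ j * of_real (p $ i * p $ j) + t * (of_real (u $ i * u $ j) * of_real (p $ i * p $ j)))"
    unfolding quad_form_def rank1_update_nth distrib_right mult.assoc ..
  also have "\<dots> = quad_form A p + t * of_real ((u \<bullet> p)\<^sup>2)"
    unfolding eq quad_form_def sum.distrib sum_distrib_left ..
  finally show ?thesis .
qed

text \<open>The matrix analogue of the upper half plane.\<close>

definition pos_imag :: "complex^'n^'n \<Rightarrow> bool" where
  "pos_imag A \<longleftrightarrow> transpose A = A \<and> (\<forall>p. p \<noteq> 0 \<longrightarrow> 0 < Im (quad_form A p))"

definition diag_shift :: "complex \<Rightarrow> real^'n^'n \<Rightarrow> complex^'n^'n" where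
  "diag_shift x A = (\<chi> i j. of_real (A $ i $ j) + (if i = j then x else 0))"

lemma diag_shift_nth [simp]:
  "diag_shift x A $ i $ j = of_real (A $ i $ j) + (if i = j then x else 0)"
  by (simp add: diag_shift_def)

lemma pos_imag_diag_shift:
  assumes "transpose A = A" "0 < Im x"
  shows "pos_imag (diag_shift x A)"
  unfolding pos_imag_def
proof (intro conjI allI impI)
  have "A $ j $ i = A $ i $ j" for i j
    using assms(1) unfolding transpose_def vec_eq_iff by simp
  then show "transpose (diag_shift x A) = diag_shift x A"
    by (auto simp: transpose_def vec_eq_iff)
  fix p :: "real^'a"
  assume "p \<noteq> 0"
  have "Im (quad_form (diag_shift x A) p) = (\<Sum>i\<in>UNIV. \<Sum>j\<in>UNIV. if i = j then Im x * (p $ i * p $ j) else 0)"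
    unfolding quad_form_def Im_sum by (intro sum.cong refl) simp
  also have "\<dots> = Im x * (p \<bullet> p)"
    by (simp add: inner_vec_def sum_distrib_left)
  finally show "0 < Im (quad_form (diag_shift x A) p)"
    using assms(2) \<open>p \<noteq> 0\<close> by simp
qed

lemma pos_imag_rank1_update:
  assumes "pos_imag A" "0 \<le> Im t"
  shows "pos_imag (rank1_update A t u)"
proof -
  have "transpose (rank1_update A t u) = rank1_update A t u"
    using assms(1) unfolding pos_imag_def
    by (simp add: vec_eq_iff transpose_def mult.commute)
  moreover have "0 < Im (quad_form (rank1_update A t u) p)" if "p \<noteq> 0" for p
    using assms that
    by (simp add: quad_form_rank1_update pos_imag_def add_pos_nonneg del: of_real_power)
  ultimately show ?thesis
    by (simp add: pos_imag_def)
qed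

text \<open>For a kernel vector \<open>w = p + \<i> * q\<close> the symmetry of \<open>A\<close>
  cancels the mixed terms of w^* A w. What remains is \<open>quad_form A p + quad_form A q\<close>,
  which would have positive imaginary part.\<close>

lemma det_pos_imag:
  assumes "pos_imag A"
  shows "det A \<noteq> 0"
proof
  assume "det A = 0"
  then obtain w where w: "A *v w = 0" "w \<noteq> 0"
    using invertible_det_nz[of A] by (auto simp: invertible_left_inverse matrix_left_invertible_ker)
  define p :: "real^'a" where "p = (\<chi> i. Re (w $ i))"
  define q :: "real^'a" where "q = (\<chi> i. Im (w $ i))"
  have sym: "A $ j $ i = A $ i $ j" for i j
    using assms unfolding pos_imag_def transpose_def vec_eq_iff by simp
  have w_eq: "w $ i = of_real (p $ i) + \<i> * of_real (q $ i)" for i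
    by (simp add: p_def q_def complex_eq_iff)
  have comm: "A $ i $ j * of_real (q $ i * p $ j) = A $ j $ i * of_real (p $ j * q $ i)" for i j
    by (simp only: sym[of j i] mult.commute[of "q $ i"])
  have swap: "(\<Sum>i\<in>UNIV. \<Sum>j\<in>UNIV. A $ i $ j * of_real (q $ i * p $ j))
      = (\<Sum>i\<in>UNIV. \<Sum>j\<in>UNIV. A $ i $ j * of_real (p $ i * q $ j))"
    unfolding comm by (rule sum.swap)
  have "0 = (\<Sum>i\<in>UNIV. cnj (w $ i) * (A *v w) $ i)"
    by (simp add: w)
  also have "\<dots> = (\<Sum>i\<in>UNIV. \<Sum>j\<in>UNIV. A $ i $ j * cnj (w $ i) * w $ j)"
    by (simp add: matrix_vector_mult_def sum_distrib_left algebra_simps)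
  also have "\<dots> = (\<Sum>i\<in>UNIV. \<Sum>j\<in>UNIV. A $ i $ j * of_real (p $ i * p $ j)
      + A $ i $ j * of_real (q $ i * q $ j)
      + (\<i> * (A $ i $ j * of_real (p $ i * q $ j)) - \<i> * (A $ i $ j * of_real (q $ i * p $ j))))"
    by (intro sum.cong refl) (simp add: w_eq algebra_simps)
  also have "\<dots> = quad_form A p + quad_form A q
      + (\<i> * (\<Sum>i\<in>UNIV. \<Sum>j\<in>UNIV. A $ i $ j * of_real (p $ i * q $ j))
         - \<i> * (\<Sum>i\<in>UNIV. \<Sum>j\<in>UNIV. A $ i $ j * of_real (q $ i * p $ j)))"
    by (simp add: quad_form_def sum.distrib sum_subtractf sum_distrib_left)
  also have "(\<Sum>i\<in>UNIV. \<Sum>j\<in>UNIV. A $ i $ j * of_real (q $ i * p $ j))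
      = (\<Sum>i\<in>UNIV. \<Sum>j\<in>UNIV. A $ i $ j * of_real (p $ i * q $ j))"
    by (rule swap)
  finally have "0 = quad_form A p + quad_form A q"
    by simp
  then have "Im (quad_form A p) + Im (quad_form A q) = 0"
    by (simp flip: plus_complex.sel(2))
  moreover have "p \<noteq> 0 \<or> q \<noteq> 0"
    using w(2) w_eq by (auto simp: vec_eq_iff)
  moreover have "Im (quad_form A 0) = 0"
    by (simp add: quad_form_def)
  ultimately show False
    using assms unfolding pos_imag_def by (smt (verit))
qed

text \<open>Centring the two-point distribution turns the average into \<^term>\<open>\<alpha> - v * \<kappa>\<close> with
  \<open>v\<close> its variance.\<close>

lemma mixed_det_average_nonzero:
  fixes A B :: "complex^'n^'n"
  assumes stable: "\<And>A B :: complex^'n^'n. pos_imag A \<Longrightarrow> pos_imag B \<Longrightarrow> mixed_det r us A B \<noteq> 0"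
    and AB: "pos_imag A" "pos_imag B" and l: "0 \<le> l" "l \<le> 1"
  shows "of_real l * mixed_det r us (rank1_update A (of_real a) u) (rank1_update B (- of_real a) u)
    + of_real (1 - l) * mixed_det r us (rank1_update A (of_real b) u) (rank1_update B (- of_real b) u) \<noteq> 0"
proof -
  define m where "m = l * a + (1 - l) * b"
  define A' where "A' = rank1_update A (of_real m) u"
  define B' where "B' = rank1_update B (- of_real m) u"
  obtain \<alpha> \<beta> \<gamma> \<kappa> where coeffs:
    "\<And>s t. mixed_det r us (rank1_update A' s u) (rank1_update B' t u) = \<alpha> + \<beta> * s + \<gamma> * t + \<kappa> * s * t"
    using mixed_det_biaffine by metis
  have shift: "rank1_update A (of_real x) u = rank1_update A' (of_real (x - m)) u"
    "rank1_update B (- of_real x) u = rank1_update B' (- of_real (x - m)) u" for x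
    by (simp_all add: A'_def B'_def)
  have "pos_imag A'" "pos_imag B'"
    unfolding A'_def B'_def using AB by (simp_all add: pos_imag_rank1_update)
  \<comment> \<open>Setting \<open>s = t\<close> gives a polynomial in one variable whose leading
    coefficient is the coefficient \<open>\<kappa>\<close> of the product \<open>s * t\<close>, the
    only one besides \<open>\<alpha>\<close> that survives the average.\<close>
  then have "\<alpha> + (\<beta> + \<gamma>) * t + \<kappa> * t\<^sup>2 \<noteq> 0" if "0 \<le> Im t" for t
    using stable[of "rank1_update A' t u" "rank1_update B' t u"] that coeffs[of t t]
    by (simp add: pos_imag_rank1_update algebra_simps power2_eq_square)
  then have "\<alpha> - of_real (l * (a - m)\<^sup>2 + (1 - l) * (b - m)\<^sup>2) * \<kappa> \<noteq> 0"
    by (rule stable_quadratic_minus) (use l in auto)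
  moreover have "of_real l * mixed_det r us (rank1_update A (of_real a) u) (rank1_update B (- of_real a) u)
    + of_real (1 - l) * mixed_det r us (rank1_update A (of_real b) u) (rank1_update B (- of_real b) u)
    = \<alpha> + (\<beta> - \<gamma>) * of_real (l * (a - m) + (1 - l) * (b - m))
      - of_real (l * (a - m)\<^sup>2 + (1 - l) * (b - m)\<^sup>2) * \<kappa>"
    unfolding shift coeffs by (simp add: algebra_simps power2_eq_square)
  moreover have "l * (a - m) + (1 - l) * (b - m) = 0"
    by (simp add: m_def algebra_simps)
  ultimately show ?thesis
    by simp
qed

lemma mixed_det_nonzero:
  fixes A B :: "complex^'n^'n"
  assumes "1 \<le> r" "pos_imag A" "pos_imag B"
  shows "mixed_det r us A B \<noteq> 0"
  using assms(2,3)
proof (induction us arbitrary: A B)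
  case Nil
  then show ?case
    by (simp add: det_pos_imag)
next
  case (Cons u us)
  show ?case
    using mixed_det_average_nonzero[OF Cons.IH Cons.prems, of "1 / r" "r - 1" u "- 1"] assms(1)
    by simp
qed

section \<open>Real coefficients as limits of stable polynomials\<close>

definition of_real_mat :: "real^'n^'n \<Rightarrow> 'a::real_field^'n^'n" where
  "of_real_mat A = (\<chi> i j. of_real (A $ i $ j))"

lemma of_real_mat_nth [simp]: "of_real_mat A $ i $ j = of_real (A $ i $ j)"
  by (simp add: of_real_mat_def)

lemma det_of_real_mat: "det (of_real_mat A) = of_real (det A)"
  by (simp add: det_def)

lemma of_real_mat_rank1_update:
  "of_real_mat (rank1_update A t u) = rank1_update (of_real_mat A) (of_real t) u"
  by (simp add: vec_eq_iff)

lemma mixed_det_of_real_mat: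
  fixes A B :: "real^'n^'n"
  shows "mixed_det r us (of_real_mat A :: 'a::real_field^'n^'n) (of_real_mat B) = of_real (mixed_det r us A B)"
proof (induction us arbitrary: A B)
  case (Cons u us)
  have "rank1_update (of_real_mat A :: 'a^'n^'n) (of_real (r - 1)) u = of_real_mat (rank1_update A (r - 1) u)"
    "rank1_update (of_real_mat B :: 'a^'n^'n) (- of_real (r - 1)) u = of_real_mat (rank1_update B (- (r - 1)) u)"
    "rank1_update (of_real_mat A :: 'a^'n^'n) (- 1) u = of_real_mat (rank1_update A (- 1) u)"
    "rank1_update (of_real_mat B :: 'a^'n^'n) 1 u = of_real_mat (rank1_update B 1 u)"
    by (simp_all add: vec_eq_iff)
  then show ?case
    by (simp only: mixed_det.simps Cons.IH of_real_mult of_real_add of_real_eq_id id_apply)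
qed (simp add: det_of_real_mat)

lemma tendsto_det:
  fixes A :: "'b \<Rightarrow> 'a::real_normed_field^'n^'n"
  assumes "\<And>i j. ((\<lambda>x. A x $ i $ j) \<longlongrightarrow> L $ i $ j) F"
  shows "((\<lambda>x. det (A x)) \<longlongrightarrow> det L) F"
  unfolding det_def by (intro tendsto_intros assms)

lemma tendsto_mixed_det:
  fixes A B :: "'b \<Rightarrow> 'a::real_normed_field^'n^'n"
  assumes "\<And>i j. ((\<lambda>x. A x $ i $ j) \<longlongrightarrow> L $ i $ j) F"
    and "\<And>i j. ((\<lambda>x. B x $ i $ j) \<longlongrightarrow> M $ i $ j) F"
  shows "((\<lambda>x. mixed_det r us (A x) (B x)) \<longlongrightarrow> mixed_det r us L M) F"
  using assms
proof (induction us arbitrary: A B L M)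
  case Nil
  then show ?case
    by (simp add: tendsto_mult tendsto_det)
next
  case (Cons u us)
  show ?case
    unfolding mixed_det.simps
    by (intro tendsto_add tendsto_mult tendsto_const Cons.IH)
      (simp_all add: Cons.prems tendsto_intros)
qed

lemma mixed_det_quadratic:
  obtains \<alpha> \<beta> \<kappa> where
    "\<And>t. mixed_det r us (rank1_update A t u) (rank1_update B t u) = \<alpha> + \<beta> * t + \<kappa> * t\<^sup>2"
proof -
  obtain \<alpha> \<beta> \<gamma> \<kappa> where
    "\<And>s t. mixed_det r us (rank1_update A s u) (rank1_update B t u) = \<alpha> + \<beta> * s + \<gamma> * t + \<kappa> * s * t"
    using mixed_det_biaffine by metis
  then show thesis
    by (intro that[of \<alpha> "\<beta> + \<gamma>" \<kappa>]) (simp add: algebra_simps power2_eq_square)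
qed

text \<open>A real symmetric \<open>Z\<close> lies on the boundary of \<open>pos_imag\<close>, so it
  is moved inside by \<open>\<i> * e\<close> times the identity, and \<open>e\<close> tends to 0.
  Nonvanishing would be lost in this limit, the weak inequality is not. As \<open>F\<close> is
  quadratic, the difference \<open>F (t + 1) - F (t - 1)\<close> is exactly twice its derivative at
  \<open>t\<close>.\<close>

lemma mixed_det_semistable:
  fixes Z :: "real^'n^'n" and u v :: "real^'n" and us :: "(real^'n) list" and r :: real and s t :: complex
  defines "F \<equiv> \<lambda>t. mixed_det r us (rank1_update (rank1_update (of_real_mat Z) s v) t u)
                (rank1_update (rank1_update (of_real_mat Z) s v) t u)"
  assumes "1 \<le> r" "transpose Z = Z" "0 \<le> Im s" "0 \<le> Im t"
  shows "Im ((F (t + 1) - F (t - 1)) * cnj (F t)) \<le> 0"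
proof -
  define Y :: "real \<Rightarrow> complex^'n^'n" where
    "Y e = rank1_update (diag_shift (\<i> * of_real e) Z) s v" for e
  define G where "G e t = mixed_det r us (rank1_update (Y e) t u) (rank1_update (Y e) t u)" for e t
  have "Im ((G e (t + 1) - G e (t - 1)) * cnj (G e t)) \<le> 0" if "0 < e" for e
  proof -
    have pos: "pos_imag (diag_shift (\<i> * of_real e) Z)"
      using assms(3) that by (intro pos_imag_diag_shift) simp_all
    obtain \<alpha> \<beta> \<kappa> where q: "\<And>t. G e t = \<alpha> + \<beta> * t + \<kappa> * t\<^sup>2"
      unfolding G_def using mixed_det_quadratic by metis
    have "\<alpha> + \<beta> * t + \<kappa> * t\<^sup>2 \<noteq> 0" if "0 \<le> Im t" for t
      unfolding q[symmetric] G_def Y_def using pos assms(2,4) that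
      by (intro mixed_det_nonzero pos_imag_rank1_update)
    from Im_deriv_times_cnj_le[OF this \<open>0 \<le> Im t\<close>]
    have "Im (2 * ((\<beta> + 2 * \<kappa> * t) * cnj (\<alpha> + \<beta> * t + \<kappa> * t\<^sup>2))) \<le> 0"
      by simp
    moreover have "G e (t + 1) - G e (t - 1) = 2 * (\<beta> + 2 * \<kappa> * t)"
      unfolding q by (simp add: algebra_simps power2_eq_square)
    ultimately show ?thesis
      unfolding q by (simp only: mult.assoc)
  qed
  then have ev: "\<forall>\<^sub>F e in at_right 0. Im ((G e (t + 1) - G e (t - 1)) * cnj (G e t)) \<le> 0"
    by (auto simp: eventually_at_filter)
  have lim: "((\<lambda>e. G e x) \<longlongrightarrow> F x) (at_right 0)" for x
  proof -
    have "((\<lambda>e. (\<i> :: complex) * of_real e) \<longlongrightarrow> \<i> * of_real 0) (at_right 0)"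
      by (intro tendsto_intros)
    then have "((\<lambda>e. rank1_update (Y e) x u $ i $ j) \<longlongrightarrow>
        rank1_update (rank1_update (of_real_mat Z) s v) x u $ i $ j) (at_right 0)" for i j
      unfolding Y_def by (cases "i = j") (auto intro!: tendsto_eq_intros)
    then show ?thesis
      unfolding G_def F_def by (intro tendsto_mixed_det)
  qed
  have "((\<lambda>e. Im ((G e (t + 1) - G e (t - 1)) * cnj (G e t)))
      \<longlongrightarrow> Im ((F (t + 1) - F (t - 1)) * cnj (F t))) (at_right 0)"
    by (intro tendsto_intros lim)
  from tendsto_upperbound[OF this ev] show ?thesis
    by simp
qed

text \<open>The point is that the coefficients are real although the arguments need not be. A
  polynomial quadratic in each variable is determined by its values at 0, 1 and -1, and there all
  the data are real.\<close>

lemma mixed_det_biquadratic: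
  fixes Z :: "real^'n^'n"
  obtains a0 a1 a2 b0 b1 b2 c0 c1 c2 :: real where
    "\<And>s t :: 'a::real_field. mixed_det r us (rank1_update (rank1_update (of_real_mat Z) s v) t u)
        (rank1_update (rank1_update (of_real_mat Z) s v) t u)
      = (of_real a0 + of_real a1 * s + of_real a2 * s\<^sup>2)
        + (of_real b0 + of_real b1 * s + of_real b2 * s\<^sup>2) * t
        + (of_real c0 + of_real c1 * s + of_real c2 * s\<^sup>2) * t\<^sup>2"
proof -
  define F :: "'a \<Rightarrow> 'a \<Rightarrow> 'a" where
    "F s t = mixed_det r us (rank1_update (rank1_update (of_real_mat Z) s v) t u)
        (rank1_update (rank1_update (of_real_mat Z) s v) t u)" for s t
  define g :: "real \<Rightarrow> real \<Rightarrow> real" where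
    "g s t = mixed_det r us (rank1_update (rank1_update Z s v) t u) (rank1_update (rank1_update Z s v) t u)" for s t
  have F_g: "F (of_real s) (of_real t) = of_real (g s t)" for s t
    by (simp add: F_def g_def flip: of_real_mat_rank1_update mixed_det_of_real_mat)
  have interpolate: "h x = h 0 + (h 1 - h (- 1)) / 2 * x + ((h 1 + h (- 1)) / 2 - h 0) * x\<^sup>2"
    if "\<And>x. h x = \<alpha> + \<beta> * x + \<kappa> * x\<^sup>2" for h :: "'a \<Rightarrow> 'a" and \<alpha> \<beta> \<kappa> x
    unfolding that by (simp add: field_simps)
  have Ft: "F s t = F s 0 + (F s 1 - F s (- 1)) / 2 * t + ((F s 1 + F s (- 1)) / 2 - F s 0) * t\<^sup>2" for s t
  proof -
    obtain \<alpha> \<beta> \<kappa> where "\<And>t. F s t = \<alpha> + \<beta> * t + \<kappa> * t\<^sup>2"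
      unfolding F_def using mixed_det_quadratic by metis
    then show ?thesis
      by (rule interpolate)
  qed
  have Fs: "F s t = F 0 t + (F 1 t - F (- 1) t) / 2 * s + ((F 1 t + F (- 1) t) / 2 - F 0 t) * s\<^sup>2" for s t
  proof -
    have "F s t = mixed_det r us (rank1_update (rank1_update (of_real_mat Z) t u) s v)
        (rank1_update (rank1_update (of_real_mat Z) t u) s v)" for s
      by (simp only: F_def rank1_update_commute[of "of_real_mat Z" s v t u])
    then obtain \<alpha> \<beta> \<kappa> where "\<And>s. F s t = \<alpha> + \<beta> * s + \<kappa> * s\<^sup>2"
      using mixed_det_quadratic by metis
    then show ?thesis
      by (rule interpolate)
  qed
  define p where "p t = g 0 t" for t
  define q where "q t = (g 1 t - g (- 1) t) / 2" for t
  define w where "w t = (g 1 t + g (- 1) t) / 2 - g 0 t" for t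
  have row: "F s (of_real t) = of_real (p t) + of_real (q t) * s + of_real (w t) * s\<^sup>2" for s t
    unfolding Fs[of s] p_def q_def w_def
    using F_g[of 0 t] F_g[of 1 t] F_g[of "-1" t] by simp
  show thesis
  proof (rule that[of "p 0" "q 0" "w 0" "(p 1 - p (- 1)) / 2" "(q 1 - q (- 1)) / 2" "(w 1 - w (- 1)) / 2"
        "(p 1 + p (- 1)) / 2 - p 0" "(q 1 + q (- 1)) / 2 - q 0" "(w 1 + w (- 1)) / 2 - w 0"],
      fold F_def)
    fix s t :: 'a
    have e: "F s 0 = of_real (p 0) + of_real (q 0) * s + of_real (w 0) * s\<^sup>2"
      "F s 1 = of_real (p 1) + of_real (q 1) * s + of_real (w 1) * s\<^sup>2"
      "F s (- 1) = of_real (p (- 1)) + of_real (q (- 1)) * s + of_real (w (- 1)) * s\<^sup>2"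
      using row[of s 0] row[of s 1] row[of s "-1"] by simp_all
    show "F s t = (of_real (p 0) + of_real (q 0) * s + of_real (w 0) * s\<^sup>2)
        + (of_real ((p 1 - p (- 1)) / 2) + of_real ((q 1 - q (- 1)) / 2) * s + of_real ((w 1 - w (- 1)) / 2) * s\<^sup>2) * t
        + (of_real ((p 1 + p (- 1)) / 2 - p 0) + of_real ((q 1 + q (- 1)) / 2 - q 0) * s
           + of_real ((w 1 + w (- 1)) / 2 - w 0) * s\<^sup>2) * t\<^sup>2"
      unfolding Ft[of s t] e by (simp add: field_simps)
  qed
qed

section \<open>Coefficient inequalities: Rayleigh, Laguerre and a single barrier step\<close>

lemma nonpos_if_add_square_nonpos:
  fixes x y :: real
  assumes "\<And>e. 0 < e \<Longrightarrow> x + e\<^sup>2 * y \<le> 0"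
  shows "x \<le> 0"
proof -
  have "((\<lambda>e. x + e\<^sup>2 * y) \<longlongrightarrow> x + 0\<^sup>2 * y) (at_right 0)"
    by (intro tendsto_intros)
  moreover have "\<forall>\<^sub>F e in at_right 0. x + e\<^sup>2 * y \<le> 0"
    using assms by (auto simp: eventually_at_filter)
  ultimately show ?thesis
    using tendsto_upperbound by fastforce
qed

text \<open>With \<open>F\<close> the polynomial and \<open>G\<close> its derivative in
  \<open>t\<close>, the imaginary part of \<open>G * cnj F\<close> is nonpositive for arguments in
  the closed upper half plane. Moving \<open>s\<close> by \<open>\<i> * e\<close> off the real axis,
  dividing by \<open>e\<close> and letting \<open>e\<close> tend to 0 gives the Rayleigh inequality
  between the mixed second derivative and the two first ones. Moving \<open>t\<close> instead gives
  the Laguerre inequality for \<open>F\<close> as a polynomial in \<open>t\<close>.\<close>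

lemma
  fixes Z :: "real^'n^'n" and s t :: real
  assumes "1 \<le> r" "transpose Z = Z"
    and coeffs: "\<And>s t :: complex. mixed_det r us (rank1_update (rank1_update (of_real_mat Z) s w) t u)
        (rank1_update (rank1_update (of_real_mat Z) s w) t u)
      = (of_real a0 + of_real a1 * s + of_real a2 * s\<^sup>2)
        + (of_real b0 + of_real b1 * s + of_real b2 * s\<^sup>2) * t
        + (of_real c0 + of_real c1 * s + of_real c2 * s\<^sup>2) * t\<^sup>2"
  defines "a \<equiv> a0 + a1 * s + a2 * s\<^sup>2" and "b \<equiv> b0 + b1 * s + b2 * s\<^sup>2"
    and "c \<equiv> c0 + c1 * s + c2 * s\<^sup>2"
    and "a' \<equiv> a1 + 2 * a2 * s" and "b' \<equiv> b1 + 2 * b2 * s" and "c' \<equiv> c1 + 2 * c2 * s"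
  shows mixed_det_rayleigh:
      "(a + b * t + c * t\<^sup>2) * (b' + 2 * c' * t) \<le> (a' + b' * t + c' * t\<^sup>2) * (b + 2 * c * t)"
    and mixed_det_laguerre: "2 * c * (a + b * t + c * t\<^sup>2) \<le> (b + 2 * c * t)\<^sup>2"
proof -
  define F where "F s t = (of_real a0 + of_real a1 * s + of_real a2 * s\<^sup>2)
        + (of_real b0 + of_real b1 * s + of_real b2 * s\<^sup>2) * t
        + (of_real c0 + of_real c1 * s + of_real c2 * s\<^sup>2) * t\<^sup>2" for s t :: complex
  define G where "G s t = (of_real b0 + of_real b1 * s + of_real b2 * s\<^sup>2)
      + 2 * (of_real c0 + of_real c1 * s + of_real c2 * s\<^sup>2) * t" for s t :: complex
  have semi: "Im (G x y * cnj (F x y)) \<le> 0" if "0 \<le> Im x" "0 \<le> Im y" for x y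
  proof -
    have "F x (y + 1) - F x (y - 1) = 2 * G x y"
      unfolding F_def G_def by algebra
    then show ?thesis
      using mixed_det_semistable[OF assms(1,2) that, of us w u, unfolded coeffs, folded F_def]
      by simp
  qed
  define f fs f2 where "f = a + b * t + c * t\<^sup>2" and "fs = a' + b' * t + c' * t\<^sup>2"
    and "f2 = a2 + b2 * t + c2 * t\<^sup>2"
  define g gs g2 where "g = b + 2 * c * t" and "gs = b' + 2 * c' * t" and "g2 = b2 + 2 * c2 * t"
  have "(gs * f - g * fs) + e\<^sup>2 * (g2 * fs - gs * f2) \<le> 0" if "0 < e" for e
  proof -
    let ?x = "Complex s e" and ?y = "of_real t"
    have "F ?x ?y = Complex (f - e\<^sup>2 * f2) (e * fs)" "G ?x ?y = Complex (g - e\<^sup>2 * g2) (e * gs)"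
      unfolding F_def G_def f_def fs_def f2_def g_def gs_def g2_def a_def b_def c_def a'_def b'_def c'_def
      by (simp_all add: complex_eq_iff power2_eq_square algebra_simps)
    then have "e * ((gs * f - g * fs) + e\<^sup>2 * (g2 * fs - gs * f2)) \<le> 0"
      using semi[of ?x ?y] that by (simp add: algebra_simps)
    then show ?thesis
      using that by (simp add: mult_le_0_iff)
  qed
  then have "gs * f - g * fs \<le> 0"
    by (rule nonpos_if_add_square_nonpos)
  then show "(a + b * t + c * t\<^sup>2) * (b' + 2 * c' * t) \<le> (a' + b' * t + c' * t\<^sup>2) * (b + 2 * c * t)"
    by (simp add: f_def fs_def g_def gs_def mult.commute)
  have "(2 * c * f - g\<^sup>2) + e\<^sup>2 * (- 2 * c\<^sup>2) \<le> 0" if "0 < e" for e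
  proof -
    let ?x = "of_real s" and ?y = "Complex t e"
    have "F ?x ?y = Complex (f - e\<^sup>2 * c) (e * g)" "G ?x ?y = Complex g (2 * c * e)"
      unfolding F_def G_def f_def g_def a_def b_def c_def
      by (simp_all add: complex_eq_iff power2_eq_square algebra_simps)
    then have "e * ((2 * c * f - g\<^sup>2) + e\<^sup>2 * (- 2 * c\<^sup>2)) \<le> 0"
      using semi[of ?x ?y] that by (simp add: algebra_simps power2_eq_square)
    then show ?thesis
      using that by (simp add: mult_le_0_iff)
  qed
  then have "2 * c * f - g\<^sup>2 \<le> 0"
    by (rule nonpos_if_add_square_nonpos)
  then show "2 * c * (a + b * t + c * t\<^sup>2) \<le> (b + 2 * c * t)\<^sup>2"
    by (simp add: f_def g_def)
qed

text \<open>Writing \<open>a + b t + c t\<^sup>2 = a (1 + \<rho> t) (1 + \<rho>' t)\<close>, the ratio in question is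
  \<open>(1 - v \<rho> \<rho>') / ((1 - \<delta> \<rho>) (1 - \<delta> \<rho>'))\<close>, which increases with \<open>\<rho>\<close> as long as
  \<open>v \<rho>' \<le> \<delta>\<close>. The proof avoids the roots and combines the Rayleigh inequalities at
  \<open>t = 0\<close> and \<open>t = - v / \<delta>\<close>.\<close>

lemma barrier_derivative_nonpos:
  fixes a b c a' b' c' v \<delta> :: real
  assumes "0 < a" "0 \<le> c" "0 < \<delta>" "\<delta>\<^sup>2 \<le> v" "v * b \<le> \<delta> * a" "v * c \<le> a"
    and r0: "a * b' \<le> a' * b"
    and r1: "\<And>t. (a + b * t + c * t\<^sup>2) * (b' + 2 * c' * t) \<le> (a' + b' * t + c' * t\<^sup>2) * (b + 2 * c * t)"
  shows "(a' - v * c') * (a - \<delta> * b + \<delta>\<^sup>2 * c) - (a - v * c) * (a' - \<delta> * b' + \<delta>\<^sup>2 * c') \<le> 0"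
proof -
  \<comment> \<open>At the point \<open>- \<tau>\<close> the linear part
    \<open>q = a - \<tau> * b\<close> is still nonnegative, which is the assumption
    \<open>v * b \<le> \<delta> * a\<close>.\<close>
  define \<tau> where "\<tau> = v / \<delta>"
  \<comment> \<open>The 2 by 2 minors of the rows \<open>(a', b', c')\<close> and
    \<open>(a, b, c)\<close>. Both Rayleigh inequalities and the goal are linear in them, and the
    relation \<open>syz\<close> eliminates \<open>W3\<close>.\<close>
  define W1 W2 W3 where "W1 = a' * b - a * b'" and "W2 = a' * c - a * c'" and "W3 = b' * c - b * c'"
  define q where "q = a - \<tau> * b"
  have v: "v = \<tau> * \<delta>"
    using \<open>0 < \<delta>\<close> by (simp add: \<tau>_def)
  have "0 < v"
    using \<open>0 < \<delta>\<close> \<open>\<delta>\<^sup>2 \<le> v\<close> by (smt (verit) zero_less_power)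
  have "0 < \<tau>"
    using \<open>0 < v\<close> \<open>0 < \<delta>\<close> by (simp add: \<tau>_def)
  have q: "0 \<le> q"
    using \<open>v * b \<le> \<delta> * a\<close> \<open>0 < \<delta>\<close> by (simp add: q_def \<tau>_def field_simps)
  have W: "0 \<le> W1"
    using r0 by (simp add: W1_def)
  have syz: "a * W3 = b * W2 - c * W1"
    unfolding W1_def W2_def W3_def by algebra
  have "0 \<le> W1 - 2 * \<tau> * W2 + \<tau>\<^sup>2 * W3"
    using r1[of "- \<tau>"] unfolding W1_def W2_def W3_def by (simp add: algebra_simps power2_eq_square)
  then have "0 \<le> a * (W1 - 2 * \<tau> * W2 + \<tau>\<^sup>2 * W3)"
    using \<open>0 < a\<close> by simp
  also have "\<dots> = W1 * (a - \<tau>\<^sup>2 * c) - \<tau> * W2 * (a + q)"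
    using syz unfolding q_def by algebra
  finally have G1: "\<tau> * W2 * (a + q) \<le> W1 * (a - \<tau>\<^sup>2 * c)"
    by simp
  define P where "P = \<delta> * W1 - (\<delta>\<^sup>2 + v) * W2 + v * \<delta> * W3"
  define g where "g = a * v + \<delta>\<^sup>2 * q"
  have g: "0 \<le> g"
    using q \<open>0 < a\<close> \<open>0 < v\<close> by (simp add: g_def)
  have aP: "a * P = W1 * \<delta> * (a - v * c) - W2 * g"
    using syz unfolding P_def g_def q_def v by algebra
  have "0 \<le> a * P"
  proof (cases "W2 \<le> 0")
    case True
    then have "W2 * g \<le> 0" "0 \<le> W1 * \<delta> * (a - v * c)"
      using g W assms by (simp_all add: mult_nonpos_nonneg)
    then show ?thesis
      using aP by simp
  next
    case False
    \<comment> \<open>The negative term \<open>- W2 * g\<close> is absorbed by \<open>G1\<close>,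
      the Rayleigh inequality at \<open>- \<tau>\<close>. The factors of \<open>W1\<close> that
      remain are compared by means of
      \<open>\<delta>\<^sup>2 \<le> v \<le> \<tau>\<^sup>2\<close>.\<close>
    have "W1 * (a - \<tau>\<^sup>2 * c) * g \<le> W1 * (v * (a + q) * (a - v * c))"
    proof -
      have "v \<le> \<tau>\<^sup>2"
        using mult_left_mono[OF \<open>\<delta>\<^sup>2 \<le> v\<close>, of v] \<open>0 < v\<close> \<open>0 < \<delta>\<close>
        by (simp add: \<tau>_def power_divide divide_simps) (simp add: power2_eq_square)
      then have "0 \<le> a * q * (v - \<delta>\<^sup>2) + c * a * v * (\<tau>\<^sup>2 - v)"
        using assms q \<open>0 < v\<close> by simp
      also have "\<dots> = v * (a + q) * (a - v * c) - (a - \<tau>\<^sup>2 * c) * g"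
        unfolding g_def v by algebra
      finally have "(a - \<tau>\<^sup>2 * c) * g \<le> v * (a + q) * (a - v * c)"
        by simp
      from mult_left_mono[OF this W] show ?thesis
        by (simp add: mult.assoc)
    qed
    moreover have "\<tau> * W2 * (a + q) * g \<le> W1 * (a - \<tau>\<^sup>2 * c) * g"
      using G1 g by (rule mult_right_mono)
    moreover have "(\<tau> * (a + q)) * (a * P)
        = W1 * (v * (a + q) * (a - v * c)) - \<tau> * W2 * (a + q) * g"
      unfolding aP v by algebra
    ultimately have "0 \<le> (\<tau> * (a + q)) * (a * P)"
      by linarith
    moreover have "0 < \<tau> * (a + q)"
      using \<open>0 < \<tau>\<close> \<open>0 < a\<close> q by simp
    ultimately show ?thesis
      using zero_le_mult_iff by (metis not_le order_less_imp_le)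
  qed
  then have "0 \<le> P"
    using \<open>0 < a\<close> by (simp add: zero_le_mult_iff)
  moreover have "(a' - v * c') * (a - \<delta> * b + \<delta>\<^sup>2 * c) - (a - v * c) * (a' - \<delta> * b' + \<delta>\<^sup>2 * c') = - P"
    unfolding P_def W1_def W2_def W3_def by algebra
  ultimately show ?thesis
    by simp
qed

lemma cross_ratio_antimono:
  fixes f g f' g' :: "real \<Rightarrow> real"
  assumes "0 \<le> s"
    and f: "\<And>x. (f has_real_derivative f' x) (at x)" and g: "\<And>x. (g has_real_derivative g' x) (at x)"
    and pos: "\<And>x. 0 \<le> x \<Longrightarrow> 0 < g x"
    and le: "\<And>x. 0 \<le> x \<Longrightarrow> f' x * g x - f x * g' x \<le> 0"
  shows "f s * g 0 \<le> f 0 * g s"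
proof -
  have "f s / g s \<le> f 0 / g 0"
  proof (rule DERIV_nonpos_imp_nonincreasing[OF \<open>0 \<le> s\<close>])
    fix x :: real
    assume x: "0 \<le> x" "x \<le> s"
    have "((\<lambda>x. f x / g x) has_real_derivative (f' x * g x - f x * g' x) / (g x * g x)) (at x)"
      using pos[OF x(1)] by (intro DERIV_divide f g) simp
    moreover have "(f' x * g x - f x * g' x) / (g x * g x) \<le> 0"
      using le[OF x(1)] by (simp add: divide_nonpos_nonneg)
    ultimately show "\<exists>y. ((\<lambda>x. f x / g x) has_real_derivative y) (at x) \<and> y \<le> 0"
      by blast
  qed
  then show ?thesis
    using pos[of s] pos[of 0] \<open>0 \<le> s\<close> by (simp add: divide_simps split: if_splits)
qed

text \<open>The weight has mean 0 and variance \<open>r - 1\<close> and enters the two arguments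
  with opposite signs, so the linear terms vanish and the mixed coefficient is multiplied by
  \<open>- (r - 1)\<close>. That coefficient is visible already when both arguments receive the same
  update \<open>t\<close>; this lets the barrier argument work with equal arguments
  throughout.\<close>

lemma mixed_det_Cons_quadratic:
  assumes "r \<noteq> 0" and q: "\<And>t. mixed_det r us (rank1_update A t u) (rank1_update B t u) = \<alpha> + \<beta> * t + \<kappa> * t\<^sup>2"
  shows "mixed_det r (u # us) A B = \<alpha> - of_real (r - 1) * \<kappa>"
proof -
  obtain a b c d where g:
    "\<And>s t. mixed_det r us (rank1_update A s u) (rank1_update B t u) = a + b * s + c * t + d * s * t"
    using mixed_det_biaffine by metis
  have "a = \<alpha>"
    using q[of 0] g[of 0 0] by simp
  moreover have "d = \<kappa>"
  proof -
    have e: "a + (b + c) + d = \<alpha> + \<beta> + \<kappa>" "a - (b + c) + d = \<alpha> - \<beta> + \<kappa>"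
      using q[of 1] g[of 1 1] q[of "-1"] g[of "-1" "-1"] by (simp_all add: algebra_simps)
    have "2 * d = (a + (b + c) + d) + (a - (b + c) + d) - 2 * a"
      by simp
    also have "\<dots> = 2 * \<kappa>"
      unfolding e using \<open>a = \<alpha>\<close> by simp
    finally have "2 * d = 2 * \<kappa>" .
    then show ?thesis
      by simp
  qed
  ultimately show ?thesis
    using \<open>r \<noteq> 0\<close> unfolding mixed_det.simps g by (simp add: field_simps)
qed

section \<open>The barrier argument\<close>

lemma quad_form_eq_inner: "quad_form A x = x \<bullet> (A *v x)" for A :: "real^'n^'n"
  by (simp add: quad_form_def inner_vec_def matrix_vector_mult_def sum_distrib_left mult_ac)

lemma rank1_update_mult_vec:
  "rank1_update A t u *v x = A *v x + (t * (u \<bullet> x)) *\<^sub>R u" for A :: "real^'n^'n"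
  by (simp add: vec_eq_iff matrix_vector_mult_def inner_vec_def sum.distrib sum_distrib_left
      sum_distrib_right algebra_simps)

lemma det_nonzero_if_coercive:
  fixes Y :: "real^'n^'n"
  assumes "0 < l" "\<And>x. l * (x \<bullet> x) \<le> quad_form Y x"
  shows "det Y \<noteq> 0"
proof
  assume "det Y = 0"
  then obtain w where w: "Y *v w = 0" "w \<noteq> 0"
    using invertible_det_nz[of Y] by (auto simp: invertible_left_inverse matrix_left_invertible_ker)
  have "l * (w \<bullet> w) \<le> 0"
    using assms(2)[of w] w by (simp add: quad_form_eq_inner)
  moreover have "0 < l * (w \<bullet> w)"
    using w assms(1) by simp
  ultimately show False
    by simp
qed

text \<open>Here \<open>\<omega>\<close> is u^T Y^{-1} u, the logarithmic derivative of
  \<open>det\<close> in the direction u u^T. The slope of the affine function follows from one more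
  value: at \<open>t = - 1 / \<omega>\<close> the updated matrix annihilates \<open>y\<close>, the
  solution of \<open>Y *v y = u\<close>. The bound combines coercivity at \<open>y\<close> with the
  Cauchy-Schwarz inequality.\<close>

lemma det_rank1_update_coercive:
  fixes Y :: "real^'n^'n"
  assumes l: "0 < l" and coercive: "\<And>x. l * (x \<bullet> x) \<le> quad_form Y x"
  obtains \<omega> where "\<omega> \<le> (u \<bullet> u) / l" "\<And>t. det (rank1_update Y t u) = det Y * (1 + t * \<omega>)"
proof -
  have "invertible Y"
    using det_nonzero_if_coercive[OF assms] invertible_det_nz by blast
  then obtain y where y: "Y *v y = u"
    by (metis invertible_right_inverse matrix_vector_mul_assoc matrix_vector_mul_lid)
  define \<omega> where "\<omega> = u \<bullet> y"
  have ly: "l * (y \<bullet> y) \<le> \<omega>"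
    using coercive[of y] by (simp add: quad_form_eq_inner y \<omega>_def inner_commute)
  have yy: "y \<bullet> y \<le> \<omega> / l"
    using ly l by (simp add: field_simps)
  show thesis
  proof (cases "\<omega> = 0")
    case True
    with yy have "y \<bullet> y \<le> 0"
      by simp
    then have "y = 0"
      by (metis inner_eq_zero_iff inner_ge_zero order_antisym)
    then have "u = 0"
      using y by auto
    then show thesis
      by (intro that[of 0]) (simp_all add: rank1_update_def)
  next
    case False
    have "0 < \<omega>"
      using ly l False by (smt (verit) inner_ge_zero mult_nonneg_nonneg)
    have "\<omega> * \<omega> \<le> (u \<bullet> u) * (y \<bullet> y)"
      using Cauchy_Schwarz_ineq[of u y] by (simp add: \<omega>_def power2_eq_square)
    also have "\<dots> \<le> (u \<bullet> u) * (\<omega> / l)"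
      by (intro mult_left_mono yy) simp
    finally have "\<omega> * \<omega> \<le> ((u \<bullet> u) / l) * \<omega>"
      by simp
    then have bound: "\<omega> \<le> (u \<bullet> u) / l"
      using \<open>0 < \<omega>\<close> by (rule mult_right_le_imp_le)
    define d where "d = det (rank1_update Y 1 u) - det Y"
    have d: "det (rank1_update Y t u) = det Y + t * d" for t
      unfolding d_def by (rule det_rank1_update)
    have "rank1_update Y (- 1 / \<omega>) u *v y = 0"
      using \<open>0 < \<omega>\<close> by (simp add: rank1_update_mult_vec y \<omega>_def)
    moreover have "y \<noteq> 0"
      using False by (auto simp: \<omega>_def)
    ultimately have "det (rank1_update Y (- 1 / \<omega>) u) = 0"
      using invertible_det_nz[of "rank1_update Y (- 1 / \<omega>) u"]
      by (auto simp: invertible_left_inverse matrix_left_invertible_ker)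
    then have "d = det Y * \<omega>"
      using d[of "- 1 / \<omega>"] \<open>0 < \<omega>\<close> by (simp add: field_simps)
    with d bound show thesis
      by (intro that[of \<omega>]) (auto simp: algebra_simps)
  qed
qed

text \<open>The coefficient \<open>k * (u \<bullet> u)\<close> has the size of the bound available
  for the logarithmic derivative in the direction u u^T. Summed up, the shifts give the quadratic
  form that the variance hypothesis of \<open>rank_one_discrepancy\<close> bounds.\<close>

fun barrier_shift :: "real \<Rightarrow> (real^'n) list \<Rightarrow> real^'n^'n \<Rightarrow> real^'n^'n" where
  "barrier_shift k [] Z = Z"
| "barrier_shift k (u # us) Z = barrier_shift k us (rank1_update Z (- (k * (u \<bullet> u))) u)"

lemma barrier_shift_rank1_update:
  "barrier_shift k us (rank1_update Z t u) = rank1_update (barrier_shift k us Z) t u"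
  by (induction us arbitrary: Z) (simp_all, simp only: rank1_update_commute[of _ t u])

lemma quad_form_barrier_shift:
  "quad_form (barrier_shift k us Z) x = quad_form Z x - k * (\<Sum>u\<leftarrow>us. (u \<bullet> u) * (u \<bullet> x)\<^sup>2)"
  by (induction us arbitrary: Z) (simp_all add: quad_form_rank1_update algebra_simps)

lemma transpose_rank1_update:
  "transpose Z = Z \<Longrightarrow> transpose (rank1_update Z t u) = rank1_update Z t u"
  by (simp add: vec_eq_iff transpose_def mult.commute)

lemma coercive_rank1_update:
  fixes Z :: "real^'n^'n"
  assumes "\<And>x. l * (x \<bullet> x) \<le> quad_form Z x" "0 \<le> t"
  shows "l * (x \<bullet> x) \<le> quad_form (rank1_update Z t u) x"
  using assms(1)[of x] assms(2) by (simp add: quad_form_rank1_update add_increasing2)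

text \<open>A negative \<open>c\<close> contradicts positivity for large \<open>t\<close>. If
  \<open>b\<close> were negative and \<open>c\<close> positive, the derivative would vanish at some
  \<open>t > 0\<close>, where the Laguerre inequality forces the value to be nonpositive.\<close>

lemma quadratic_pos_imp:
  fixes a b c :: real
  assumes pos: "\<And>t. 0 \<le> t \<Longrightarrow> 0 < a + b * t + c * t\<^sup>2"
    and lag: "\<And>t. 2 * c * (a + b * t + c * t\<^sup>2) \<le> (b + 2 * c * t)\<^sup>2"
  shows "0 \<le> c" "0 \<le> b"
proof -
  show c: "0 \<le> c"
  proof (rule ccontr)
    assume "\<not> 0 \<le> c"
    then have "c < 0" by simp
    define t where "t = (\<bar>a\<bar> + \<bar>b\<bar>) / - c + 1"
    have t: "1 \<le> t" "c * t = - (\<bar>a\<bar> + \<bar>b\<bar>) + c"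
      using \<open>c < 0\<close> by (simp_all add: t_def field_simps divide_nonneg_neg add_nonneg_nonneg)
    have "a \<le> \<bar>a\<bar> * t"
      using t(1) mult_left_mono[of 1 t "\<bar>a\<bar>"] by linarith
    then have "a + b * t + c * t\<^sup>2 \<le> \<bar>a\<bar> * t + \<bar>b\<bar> * t + (c * t) * t"
      using t(1) by (simp add: power2_eq_square mult_right_mono add_mono)
    also have "\<dots> = c * t"
      unfolding t(2) by (simp add: algebra_simps t(2))
    also have "\<dots> < 0"
      using \<open>c < 0\<close> t(1) by (simp add: mult_neg_pos)
    finally show False
      using pos[of t] t(1) by simp
  qed
  show "0 \<le> b"
  proof (rule ccontr)
    assume "\<not> 0 \<le> b"
    then have "b < 0" by simp
    show False
    proof (cases "c = 0")
      case True
      have "0 < a + b * (\<bar>a\<bar> / - b)"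
        using pos[of "\<bar>a\<bar> / - b"] True \<open>b < 0\<close> by (simp add: divide_nonneg_neg)
      then show False
        using \<open>b < 0\<close> pos[of 0] by simp
    next
      case False
      with c have "0 < c" by simp
      define t where "t = - b / (2 * c)"
      have "0 \<le> t" "b + 2 * c * t = 0"
        using \<open>0 < c\<close> \<open>b < 0\<close> by (simp_all add: t_def divide_nonpos_pos)
      then show False
        using lag[of t] pos[of t] \<open>0 < c\<close> by (simp add: mult_le_0_iff)
    qed
  qed
qed

lemma linear_coeff_le:
  fixes b c d :: real
  assumes "\<And>t. 0 < t \<Longrightarrow> b * t + c * t\<^sup>2 \<le> d * t"
  shows "b \<le> d"
proof -
  have "b - d + t * c \<le> 0" if "0 < t" for t
  proof -
    have "t * (b - d + t * c) \<le> 0"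
      using assms[OF that] by (simp add: algebra_simps power2_eq_square)
    then show ?thesis
      using that by (simp add: mult_le_0_iff)
  qed
  then have "\<forall>\<^sub>F t in at_right 0. b - d + t * c \<le> 0"
    by (auto simp: eventually_at_filter)
  moreover have "((\<lambda>t. b - d + t * c) \<longlongrightarrow> b - d + 0 * c) (at_right 0)"
    by (intro tendsto_intros)
  ultimately have "b - d + 0 * c \<le> 0"
    using tendsto_upperbound by fastforce
  then show ?thesis by simp
qed

text \<open>The second part says that the growth of the polynomial along any rank-one direction is
  at most that of the squared determinant of the shifted matrix; squared, because \<open>Z\<close>
  occurs in two determinants. Coercivity with constant \<open>2 / k\<close> bounds the logarithmic
  derivative of that square in the direction u u^T by \<open>k * (u \<bullet> u)\<close>. This is
  the shift coefficient divided by \<open>r - 1\<close>, as the next averaging step requires. All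
  \<open>w\<close> and \<open>s\<close> are included because the step in direction \<open>u\<close>
  has to preserve the comparison in every other direction.\<close>

lemma mixed_det_barrier:
  fixes Z :: "real^'n^'n"
  assumes r: "1 < r" and k: "0 < k"
    and small: "\<And>u. u \<in> set us \<Longrightarrow> u \<noteq> 0 \<and> (r - 1) * (k * (u \<bullet> u))\<^sup>2 \<le> 1"
    and sym: "transpose Z = Z"
    and coercive: "\<And>x. 2 / k * (x \<bullet> x) \<le> quad_form (barrier_shift ((r - 1) * k) us Z) x"
  shows "0 < mixed_det r us Z Z \<and> (\<forall>w s. 0 \<le> s \<longrightarrow>
     mixed_det r us (rank1_update Z s w) (rank1_update Z s w) * (det (barrier_shift ((r - 1) * k) us Z))\<^sup>2
       \<le> mixed_det r us Z Z * (det (rank1_update (barrier_shift ((r - 1) * k) us Z) s w))\<^sup>2)"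
  using small sym coercive
proof (induction us arbitrary: Z)
  case Nil
  then have "det Z \<noteq> 0"
    using det_nonzero_if_coercive[of "2 / k" Z] k by simp
  then show ?case
    by (auto simp: power2_eq_square zero_less_mult_iff not_less_iff_gr_or_eq)
next
  case (Cons u us)
  define v where "v = r - 1"
  define K where "K = (r - 1) * k"
  define \<delta> where "\<delta> = K * (u \<bullet> u)"
  have "u \<noteq> 0" "0 < v" and uk: "v * (k * (u \<bullet> u))\<^sup>2 \<le> 1"
    using Cons.prems(1)[of u] r by (simp_all add: v_def)
  then have "0 < \<delta>"
    using k r by (simp add: \<delta>_def K_def)
  have \<delta>v: "\<delta>\<^sup>2 \<le> v"
    using mult_left_mono[OF uk, of v] \<open>0 < v\<close>
    by (simp add: \<delta>_def K_def v_def power2_eq_square algebra_simps)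
  let ?Y = "barrier_shift K us Z"
  define Y' where "Y' = barrier_shift K (u # us) Z"
  have Y': "Y' = rank1_update ?Y (- \<delta>) u"
    by (simp add: Y'_def barrier_shift_rank1_update \<delta>_def)
  have Y: "?Y = rank1_update Y' \<delta> u"
    unfolding Y' by simp
  have coY': "2 / k * (x \<bullet> x) \<le> quad_form Y' x" for x
    using Cons.prems(3) by (simp only: K_def Y'_def)
  have coY: "2 / k * (x \<bullet> x) \<le> quad_form ?Y x" for x
    unfolding Y using coY' \<open>0 < \<delta>\<close> by (intro coercive_rank1_update) auto
  have IH: "0 < mixed_det r us X X \<and> (\<forall>w s. 0 \<le> s \<longrightarrow>
     mixed_det r us (rank1_update X s w) (rank1_update X s w) * (det (barrier_shift K us X))\<^sup>2
       \<le> mixed_det r us X X * (det (rank1_update (barrier_shift K us X) s w))\<^sup>2)"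
    if "transpose X = X" "\<And>x. 2 / k * (x \<bullet> x) \<le> quad_form (barrier_shift K us X) x" for X
    using Cons.IH[folded K_def, OF _ that] Cons.prems(1) by (meson list.set_intros(2))
  have main: "0 < mixed_det r (u # us) Z Z \<and>
     mixed_det r (u # us) (rank1_update Z s w) (rank1_update Z s w) * (det Y')\<^sup>2
       \<le> mixed_det r (u # us) Z Z * (det (rank1_update Y' s w))\<^sup>2" if "0 \<le> s" for s w
  proof -
    \<comment> \<open>The coefficients are taken from complex arguments, where stability speaks
      about them; \<open>f\<close> then restricts the identity to the reals.\<close>
    obtain a0 a1 a2 b0 b1 b2 c0 c1 c2 where coeffs:
      "\<And>s t :: complex. mixed_det r us (rank1_update (rank1_update (of_real_mat Z) s w) t u)
          (rank1_update (rank1_update (of_real_mat Z) s w) t u)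
        = (of_real a0 + of_real a1 * s + of_real a2 * s\<^sup>2)
          + (of_real b0 + of_real b1 * s + of_real b2 * s\<^sup>2) * t
          + (of_real c0 + of_real c1 * s + of_real c2 * s\<^sup>2) * t\<^sup>2"
      by (rule mixed_det_biquadratic[where 'a = complex]) (rule that)
    define a b c where "a s = a0 + a1 * s + a2 * s\<^sup>2" and "b s = b0 + b1 * s + b2 * s\<^sup>2"
      and "c s = c0 + c1 * s + c2 * s\<^sup>2" for s :: real
    define a' b' c' where "a' s = a1 + 2 * a2 * s" and "b' s = b1 + 2 * b2 * s"
      and "c' s = c1 + 2 * c2 * s" for s :: real
    have r1: "1 \<le> r"
      using r by simp
    note rayleigh = mixed_det_rayleigh[OF r1 Cons.prems(2) coeffs, folded a_def b_def c_def a'_def b'_def c'_def]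
    note laguerre = mixed_det_laguerre[OF r1 Cons.prems(2) coeffs, folded a_def b_def c_def a'_def b'_def c'_def]
    let ?Z = "\<lambda>s. rank1_update Z s w"
    have f: "mixed_det r us (rank1_update (?Z s) t u) (rank1_update (?Z s) t u) = a s + b s * t + c s * t\<^sup>2" for s t
    proof -
      have "complex_of_real (mixed_det r us (rank1_update (?Z s) t u) (rank1_update (?Z s) t u))
         = of_real (a s + b s * t + c s * t\<^sup>2)"
        using coeffs[of "of_real s" "of_real t"]
        by (simp add: a_def b_def c_def flip: mixed_det_of_real_mat of_real_mat_rank1_update)
      then show ?thesis
        by (simp only: of_real_eq_iff)
    qed
    \<comment> \<open>\<open>D\<close> is the polynomial of \<open>us\<close> at the shifted
      argument Z - \<delta> u u^T. The induction hypothesis applies to it with the shifted matrix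
      \<open>Y'\<close> that also belongs to \<open>u # us\<close> and \<open>Z\<close>.\<close>
    define D where "D s = a s - \<delta> * b s + \<delta>\<^sup>2 * c s" for s
    have D: "mixed_det r us (rank1_update (rank1_update Z (- \<delta>) u) s w) (rank1_update (rank1_update Z (- \<delta>) u) s w) = D s" for s
      using f[of s "- \<delta>"] by (simp add: D_def rank1_update_commute[of Z s w])
    have N: "mixed_det r (u # us) (?Z s) (?Z s) = a s - v * c s" for s
      using mixed_det_Cons_quadratic[of r us "?Z s" u "?Z s", OF _ f] r by (simp add: v_def)
    have DIH: "0 < D s" "D s * (det Y')\<^sup>2 \<le> D 0 * (det (rank1_update Y' s w))\<^sup>2" if "0 \<le> s" for s
    proof -
      have sy: "transpose (rank1_update Z (- \<delta>) u) = rank1_update Z (- \<delta>) u"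
        using Cons.prems(2) by (rule transpose_rank1_update)
      have sh: "barrier_shift K us (rank1_update Z (- \<delta>) u) = Y'"
        by (simp add: Y' barrier_shift_rank1_update)
      have "2 / k * (x \<bullet> x) \<le> quad_form (barrier_shift K us (rank1_update (rank1_update Z (- \<delta>) u) s w)) x" for x
        unfolding barrier_shift_rank1_update[of K us _ s w] sh using coY' that by (rule coercive_rank1_update)
      from IH[OF transpose_rank1_update[OF sy] this] show "0 < D s"
        by (simp only: D)
      show "D s * (det Y')\<^sup>2 \<le> D 0 * (det (rank1_update Y' s w))\<^sup>2"
        using IH[OF sy, unfolded sh, OF coY', THEN conjunct2, rule_format, OF that, of w] D[of s] D[of 0]
        by simp
    qed
    have props: "0 < a s" "0 \<le> c s" "v * b s \<le> \<delta> * a s" "v * c s \<le> a s / 2" if "0 \<le> s" for s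
    proof -
      have sy: "transpose (?Z s) = ?Z s"
        using Cons.prems(2) by (rule transpose_rank1_update)
      have sh: "barrier_shift K us (?Z s) = rank1_update ?Y s w"
        by (rule barrier_shift_rank1_update)
      have co: "2 / k * (x \<bullet> x) \<le> quad_form (barrier_shift K us (?Z s)) x" for x
        unfolding sh using coY that by (rule coercive_rank1_update)
      have pos: "0 < a s + b s * t + c s * t\<^sup>2" if "0 \<le> t" for t
      proof -
        have "2 / k * (x \<bullet> x) \<le> quad_form (barrier_shift K us (rank1_update (?Z s) t u)) x" for x
          unfolding barrier_shift_rank1_update[of K us _ t u] using co that by (rule coercive_rank1_update)
        from IH[OF transpose_rank1_update[OF sy] this] show ?thesis
          by (simp only: f)
      qed
      show a: "0 < a s"
        using pos[of 0] by simp
      show "0 \<le> c s"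
        using quadratic_pos_imp[OF pos laguerre] by auto
      have b: "0 \<le> b s"
        using quadratic_pos_imp[OF pos laguerre] by auto
      let ?X = "barrier_shift K us (?Z s)"
      obtain \<omega> where \<omega>: "\<omega> \<le> (u \<bullet> u) / (2 / k)" "\<And>t. det (rank1_update ?X t u) = det ?X * (1 + t * \<omega>)"
        using det_rank1_update_coercive[of "2 / k" ?X u] co k by auto
      have "det ?X \<noteq> 0"
        using det_nonzero_if_coercive[of "2 / k" ?X] co k by simp
      \<comment> \<open>The induction hypothesis in the direction \<open>u\<close> itself, against
        the factor \<open>(1 + t * \<omega>)\<^sup>2\<close>. Comparing the linear terms for small
        \<open>t\<close> gives \<open>b s \<le> 2 * \<omega> * a s\<close>.\<close>
      have "b s * t + (c s - a s * \<omega>\<^sup>2) * t\<^sup>2 \<le> 2 * \<omega> * a s * t" if "0 < t" for t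
      proof -
        have "(a s + b s * t + c s * t\<^sup>2) * (det ?X)\<^sup>2 \<le> a s * (det ?X * (1 + t * \<omega>))\<^sup>2"
          using IH[OF sy co, THEN conjunct2, rule_format, of t u] that f[of s t] f[of s 0] \<omega>(2)[of t]
          by simp
        then have "(a s + b s * t + c s * t\<^sup>2) * (det ?X)\<^sup>2 \<le> (a s * (1 + t * \<omega>)\<^sup>2) * (det ?X)\<^sup>2"
          by (simp add: power_mult_distrib mult_ac)
        then have "a s + b s * t + c s * t\<^sup>2 \<le> a s * (1 + t * \<omega>)\<^sup>2"
          using \<open>det ?X \<noteq> 0\<close> by simp
        then show ?thesis
          by (simp add: algebra_simps power2_eq_square)
      qed
      then have "b s \<le> 2 * \<omega> * a s"
        by (rule linear_coeff_le)
      also have "\<dots> \<le> (k * (u \<bullet> u)) * a s"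
        using \<omega>(1) a k by (intro mult_right_mono) (simp_all add: field_simps)
      finally have "v * b s \<le> v * ((k * (u \<bullet> u)) * a s)"
        using \<open>0 < v\<close> by simp
      also have "\<dots> = \<delta> * a s"
        by (simp add: \<delta>_def K_def v_def)
      finally show vb: "v * b s \<le> \<delta> * a s" .
      \<comment> \<open>At \<open>t = 0\<close> the Laguerre inequality is
        \<open>2 * c s * a s \<le> (b s)\<^sup>2\<close>. Its factor 2 yields \<open>a s / 2\<close>
        instead of \<open>a s\<close>, so that the averaged value \<open>a s - v * c s\<close> is
        strictly positive.\<close>
      have "(2 * a s * v) * (v * c s) = v\<^sup>2 * (2 * c s * a s)"
        by (simp add: power2_eq_square)
      also have "\<dots> \<le> v\<^sup>2 * (b s)\<^sup>2"
        using laguerre[of s 0] by (intro mult_left_mono) (simp_all add: mult_ac)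
      also have "\<dots> \<le> (\<delta> * a s)\<^sup>2"
        using power_mono[OF vb, of 2] b \<open>0 < v\<close> by (simp add: power_mult_distrib)
      also have "\<dots> \<le> v * (a s)\<^sup>2"
        using \<delta>v by (simp add: power_mult_distrib mult_right_mono)
      also have "\<dots> = (2 * a s * v) * (a s / 2)"
        by (simp add: power2_eq_square)
      finally show "v * c s \<le> a s / 2"
        using a \<open>0 < v\<close> by simp
    qed
    \<comment> \<open>The averaged polynomial divided by \<open>D\<close> decreases in
      \<open>s\<close>. Multiplying with the bound for \<open>D\<close> and cancelling
      \<open>D 0\<close> transfers that bound to the averaged polynomial.\<close>
    have "(a s - v * c s) * D 0 \<le> (a 0 - v * c 0) * D s"
    proof (rule cross_ratio_antimono[OF \<open>0 \<le> s\<close>])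
      have da: "(a has_real_derivative a' x) (at x)" and db: "(b has_real_derivative b' x) (at x)"
        and dc: "(c has_real_derivative c' x) (at x)" for x
        unfolding a_def b_def c_def a'_def b'_def c'_def by (auto intro!: derivative_eq_intros)
      show "((\<lambda>s. a s - v * c s) has_real_derivative a' x - v * c' x) (at x)" for x
        by (auto intro!: derivative_eq_intros da dc)
      show "(D has_real_derivative a' x - \<delta> * b' x + \<delta>\<^sup>2 * c' x) (at x)" for x
        unfolding D_def by (auto intro!: derivative_eq_intros da db dc)
      show "0 < D x" if "0 \<le> x" for x
        using DIH that by blast
      show "(a' x - v * c' x) * D x - (a x - v * c x) * (a' x - \<delta> * b' x + \<delta>\<^sup>2 * c' x) \<le> 0" if "0 \<le> x" for x
        unfolding D_def
      proof (rule barrier_derivative_nonpos[OF _ _ \<open>0 < \<delta>\<close> \<delta>v])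
        show "a x * b' x \<le> a' x * b x"
          using rayleigh[of x 0] by simp
      qed (use props[OF that] rayleigh[of x] in auto)
    qed
    from mult_right_mono[OF this, of "(det Y')\<^sup>2"]
    have "((a s - v * c s) * (det Y')\<^sup>2) * D 0 \<le> ((a 0 - v * c 0) * D s) * (det Y')\<^sup>2"
      by (simp add: mult_ac)
    also have "\<dots> = (a 0 - v * c 0) * (D s * (det Y')\<^sup>2)"
      by (simp add: mult_ac)
    also have "\<dots> \<le> (a 0 - v * c 0) * (D 0 * (det (rank1_update Y' s w))\<^sup>2)"
      using DIH(2)[OF that] props[of 0] by (intro mult_left_mono) auto
    finally have "(a s - v * c s) * (det Y')\<^sup>2 \<le> (a 0 - v * c 0) * (det (rank1_update Y' s w))\<^sup>2"
      using DIH(1)[of 0] by (simp add: mult_ac)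
    moreover have "0 < a 0 - v * c 0"
      using props[of 0] by simp
    ultimately show ?thesis
      using N[of s] N[of 0] by simp
  qed
  show ?case
    unfolding K_def[symmetric] Y'_def[symmetric] using main main[of 0] by blast
qed

section \<open>Interlacing\<close>

definition monic_of_degree :: "nat \<Rightarrow> complex poly \<Rightarrow> bool" where
  "monic_of_degree n p \<longleftrightarrow> Polynomial.degree p = n \<and> coeff p n = 1"

lemma monic_of_degreeI: "Polynomial.degree p \<le> n \<Longrightarrow> coeff p n = 1 \<Longrightarrow> monic_of_degree n p"
  unfolding monic_of_degree_def using le_degree[of p n] by fastforce

lemma monic_of_degree_0: "monic_of_degree 0 p \<Longrightarrow> p = 1"
  unfolding monic_of_degree_def by (metis coeff_pCons_0 degree_eq_zeroE one_pCons)

lemma monic_of_degree_mult: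
  "monic_of_degree m p \<Longrightarrow> monic_of_degree n q \<Longrightarrow> monic_of_degree (m + n) (p * q)"
  by (intro monic_of_degreeI) (auto simp: monic_of_degree_def coeff_mult_degree_sum intro: order_trans[OF degree_mult_le])

lemma monic_of_degree_convex:
  assumes "monic_of_degree n p" "monic_of_degree n q"
  shows "monic_of_degree n (smult (of_real l) p + smult (of_real (1 - l)) q)"
  using assms
  by (intro monic_of_degreeI degree_add_le order_trans[OF degree_smult_le]) (auto simp: monic_of_degree_def)

lemma monic_of_degree_Suc_factor:
  assumes "monic_of_degree (Suc n) p"
  obtains r q where "p = [:- r, 1:] * q" "monic_of_degree n q"
proof -
  have p: "Polynomial.degree p = Suc n" "coeff p (Suc n) = 1"
    using assms by (auto simp: monic_of_degree_def)
  then have "\<not> constant (poly p)"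
    by (simp add: constant_degree)
  then obtain r where "poly p r = 0"
    using fundamental_theorem_of_algebra by blast
  then obtain q where q: "p = [:- r, 1:] * q"
    by (auto simp: poly_eq_0_iff_dvd dvd_def)
  have "q \<noteq> 0"
    using p q by auto
  then have "Polynomial.degree p = Suc (Polynomial.degree q)"
    unfolding q by (subst degree_mult_eq) auto
  moreover have "coeff p (Suc (Polynomial.degree q)) = coeff q (Polynomial.degree q)"
    using coeff_mult_degree_sum[of "[:- r, 1:]" q] by (simp add: q)
  ultimately have "monic_of_degree n q"
    using p by (simp add: monic_of_degree_def)
  with q show thesis
    by (rule that)
qed

text \<open>Used in contrapositive form, as continuity of roots: a monic polynomial with a small
  value at \<open>y\<close> has a root near \<open>y\<close>.\<close>

lemma power_le_norm_poly:
  assumes "monic_of_degree n p" "0 \<le> e" "\<And>z. poly p z = 0 \<Longrightarrow> e \<le> cmod (y - z)"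
  shows "e ^ n \<le> cmod (poly p y)"
  using assms
proof (induction n arbitrary: p)
  case 0
  then show ?case
    using monic_of_degree_0 by force
next
  case (Suc n)
  obtain r q where p: "p = [:- r, 1:] * q" and q: "monic_of_degree n q"
    using monic_of_degree_Suc_factor[OF Suc.prems(1)] by blast
  have "e * e ^ n \<le> cmod (y - r) * cmod (poly q y)"
    using Suc.prems(2,3) Suc.IH[OF q Suc.prems(2)] by (intro mult_mono) (auto simp: p)
  then show ?case
    by (simp add: p norm_mult[symmetric] algebra_simps)
qed

lemma poly_pos_beyond_roots:
  assumes "monic_of_degree n p" "\<And>z. poly p z = 0 \<Longrightarrow> Im z = 0 \<and> Re z < y"
  shows "Im (poly p (of_real y)) = 0 \<and> 0 < Re (poly p (of_real y))"
  using assms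
proof (induction n arbitrary: p)
  case 0
  then show ?case
    using monic_of_degree_0 by force
next
  case (Suc n)
  obtain r q where p: "p = [:- r, 1:] * q" and q: "monic_of_degree n q"
    using monic_of_degree_Suc_factor[OF Suc.prems(1)] by blast
  have "Im (poly q (of_real y)) = 0 \<and> 0 < Re (poly q (of_real y))"
    using Suc.prems(2) by (intro Suc.IH[OF q]) (simp add: p)
  moreover have "Im r = 0" "Re r < y"
    using Suc.prems(2)[of r] by (simp_all add: p)
  moreover have "poly p (of_real y) = (of_real y - r) * poly q (of_real y)"
    by (simp add: p algebra_simps)
  ultimately show ?case
    by simp
qed

text \<open>If \<open>f\<close> had a root in [\<alpha>, \<infinity>), take the least parameter
  \<tau> for which \<open>q\<close> has one there. Both endpoints are positive at \<alpha>, so that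
  root lies strictly beyond \<alpha>. For slightly smaller parameters there is a root nearby, which
  is real and therefore still in [\<alpha>, \<infinity>), against minimality. No root has to be
  followed or counted.\<close>

lemma no_root_along_segment:
  fixes f h :: "complex poly"
  defines "q \<equiv> \<lambda>\<tau>. smult (of_real \<tau>) f + smult (of_real (1 - \<tau>)) h"
  assumes f: "monic_of_degree n f" and h: "monic_of_degree n h"
    and real: "\<And>\<tau> z. 0 \<le> \<tau> \<Longrightarrow> \<tau> \<le> 1 \<Longrightarrow> poly (q \<tau>) z = 0 \<Longrightarrow> Im z = 0"
    and h0: "\<And>x. \<alpha> \<le> x \<Longrightarrow> poly h (of_real x) \<noteq> 0"
    and f\<alpha>: "0 < Re (poly f (of_real \<alpha>))"
    and x: "\<alpha> \<le> x"
  shows "poly f (of_real x) \<noteq> 0"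
proof
  assume "poly f (of_real x) = 0"
  have poly_q: "poly (q \<tau>) z = of_real \<tau> * poly f z + of_real (1 - \<tau>) * poly h z" for \<tau> z
    by (simp add: q_def)
  have real_f: "Im z = 0" if "poly f z = 0" for z
    using real[of 1 z] that by (simp add: poly_q)
  have real_h: "Im z = 0" if "poly h z = 0" for z
    using real[of 0 z] that by (simp add: poly_q)
  have h\<alpha>: "0 < Re (poly h (of_real \<alpha>))"
  proof (rule poly_pos_beyond_roots[OF h, THEN conjunct2])
    fix z assume z: "poly h z = 0"
    then have "z = of_real (Re z)"
      using real_h by (simp add: complex_eq_iff)
    then show "Im z = 0 \<and> Re z < \<alpha>"
      using h0[of "Re z"] z real_h by (metis not_le)
  qed
  have "f \<noteq> 0" "h \<noteq> 0"
    using f h by (auto simp: monic_of_degree_def)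
  then have fin: "finite (Re ` {z. poly f z = 0 \<or> poly h z = 0})"
    using poly_roots_finite[of f] poly_roots_finite[of h] by (simp add: Collect_disj_eq)
  \<comment> \<open>Beyond \<open>R\<close> both \<open>f\<close> and \<open>h\<close> are positive,
    hence so is every \<open>q \<tau>\<close>. This confines the roots under consideration to a
    compact set.\<close>
  define R where "R = Max (Re ` {z. poly f z = 0 \<or> poly h z = 0}) + 1"
  have R: "Re z < R" if "poly f z = 0 \<or> poly h z = 0" for z
    using Max_ge[OF fin, of "Re z"] that by (force simp: R_def)
  have bounded: "poly (q \<tau>) (of_real y) \<noteq> 0" if "0 \<le> \<tau>" "\<tau> \<le> 1" "R \<le> y" for \<tau> y
  proof -
    have "0 < Re (poly f (of_real y))" "0 < Re (poly h (of_real y))"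
      using R \<open>R \<le> y\<close> real_f real_h
      by (auto intro!: poly_pos_beyond_roots[OF f, THEN conjunct2] poly_pos_beyond_roots[OF h, THEN conjunct2])
        (meson less_le_trans)+
    then have "0 < \<tau> * Re (poly f (of_real y)) + (1 - \<tau>) * Re (poly h (of_real y))"
      using that by (cases "\<tau> = 0") (auto intro: add_pos_nonneg)
    then have "0 < Re (poly (q \<tau>) (of_real y))"
      by (simp add: poly_q)
    then show ?thesis
      by auto
  qed
  define K where "K = {(\<tau>, y). \<tau> \<in> {0..1} \<and> y \<in> {\<alpha>..R} \<and> poly (q \<tau>) (of_real y) = 0}"
  have "K = ({0..1} \<times> {\<alpha>..R}) \<inter> {t. poly (q (fst t)) (of_real (snd t)) = 0}"
    by (auto simp: K_def)
  moreover have "closed {t. poly (q (fst t)) (of_real (snd t)) = 0}"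
    unfolding poly_q by (intro closed_Collect_eq continuous_intros)
  ultimately have "compact K"
    by (simp add: compact_Int_closed compact_Times)
  then have "compact (fst ` K)"
    by (intro compact_continuous_image continuous_intros)
  moreover have "(1, x) \<in> K"
    using \<open>poly f (of_real x) = 0\<close> x R[of "of_real x"] by (auto simp: K_def poly_q)
  ultimately obtain \<tau> where "\<tau> \<in> fst ` K" and min: "\<And>t. t \<in> fst ` K \<Longrightarrow> \<tau> \<le> t"
    using compact_attains_inf[of "fst ` K"] by blast
  then obtain y where \<tau>: "0 \<le> \<tau>" "\<tau> \<le> 1" and y: "\<alpha> \<le> y" "y \<le> R" "poly (q \<tau>) (of_real y) = 0"
    by (auto simp: K_def)
  have "\<tau> \<noteq> 0"
    using y h0[of y] by (auto simp: poly_q)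
  have "0 < \<tau> * Re (poly f (of_real \<alpha>)) + (1 - \<tau>) * Re (poly h (of_real \<alpha>))"
    using f\<alpha> h\<alpha> \<tau> \<open>\<tau> \<noteq> 0\<close> by (intro add_pos_nonneg) auto
  then have "0 < Re (poly (q \<tau>) (of_real \<alpha>))"
    by (simp add: poly_q)
  then have "\<alpha> < y"
    using y by (cases "\<alpha> = y") auto
  \<comment> \<open>Since \<open>q \<tau>\<close> vanishes at \<open>y\<close>, the value of
    \<open>q s\<close> there has modulus \<open>\<bar>s - \<tau>\<bar> * D\<close>. Once it is below
    \<open>(y - \<alpha>) ^ n\<close>, some root is closer to \<open>y\<close> than \<alpha>
    is.\<close>
  define D where "D = cmod (poly f (of_real y) - poly h (of_real y))"
  have "((\<lambda>s. \<bar>s - \<tau>\<bar> * D) \<longlongrightarrow> \<bar>\<tau> - \<tau>\<bar> * D) (at_left \<tau>)"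
    by (intro tendsto_intros)
  then have "\<forall>\<^sub>F s in at_left \<tau>. \<bar>s - \<tau>\<bar> * D < (y - \<alpha>) ^ n"
    using \<open>\<alpha> < y\<close> by (intro order_tendstoD) auto
  moreover have "\<forall>\<^sub>F s in at_left \<tau>. s \<in> {0<..<\<tau>}"
    using \<tau> \<open>\<tau> \<noteq> 0\<close> by (intro eventually_at_left_real) auto
  ultimately have "\<forall>\<^sub>F s in at_left \<tau>. \<bar>s - \<tau>\<bar> * D < (y - \<alpha>) ^ n \<and> s \<in> {0<..<\<tau>}"
    by (rule eventually_conj)
  then obtain s where s: "\<bar>s - \<tau>\<bar> * D < (y - \<alpha>) ^ n" "0 < s" "s < \<tau>"
    using eventually_happens[of _ "at_left \<tau>"] trivial_limit_at_left_real by fastforce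
  have "poly (q s) (of_real y) = poly (q \<tau>) (of_real y) + of_real (s - \<tau>) * (poly f (of_real y) - poly h (of_real y))"
    by (simp add: poly_q algebra_simps)
  then have "cmod (poly (q s) (of_real y)) = \<bar>s - \<tau>\<bar> * D"
    using y by (simp add: D_def norm_mult del: of_real_diff)
  then have "\<not> (y - \<alpha>) ^ n \<le> cmod (poly (q s) (of_real y))"
    using s by simp
  moreover have "monic_of_degree n (q s)"
    unfolding q_def using f h by (rule monic_of_degree_convex)
  ultimately obtain z where z: "poly (q s) z = 0" "cmod (of_real y - z) < y - \<alpha>"
    using power_le_norm_poly[of n "q s" "y - \<alpha>" "of_real y"] \<open>\<alpha> < y\<close> by force
  have "Im z = 0"
    using real[of s z] z s \<tau> by simp
  then have z_real: "z = of_real (Re z)"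
    by (simp add: complex_eq_iff)
  have "\<bar>y - Re z\<bar> < y - \<alpha>"
    using z(2) abs_Re_le_cmod[of "of_real y - z"] by simp
  then have "\<alpha> \<le> Re z"
    by simp
  moreover have "Re z \<le> R"
    using bounded[of s "Re z"] z s \<tau> z_real by (metis less_eq_real_def nle_le order_trans)
  ultimately have "(s, Re z) \<in> K"
    using z s \<tau> z_real by (simp add: K_def)
  then have "\<tau> \<le> s"
    using min by force
  with s show False
    by simp
qed

text \<open>The interlacing step of Marcus, Spielman and Srivastava.\<close>

lemma no_root_of_convex_combination:
  fixes f g :: "complex poly"
  defines "q \<equiv> \<lambda>\<tau>. smult (of_real \<tau>) f + smult (of_real (1 - \<tau>)) g"
  assumes f: "monic_of_degree n f" and g: "monic_of_degree n g"
    and real: "\<And>\<tau> z. 0 \<le> \<tau> \<Longrightarrow> \<tau> \<le> 1 \<Longrightarrow> poly (q \<tau>) z = 0 \<Longrightarrow> Im z = 0"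
    and l: "0 \<le> l" "l \<le> 1" and ql: "\<And>x. \<alpha> \<le> x \<Longrightarrow> poly (q l) (of_real x) \<noteq> 0"
  shows "(\<forall>x\<ge>\<alpha>. poly f (of_real x) \<noteq> 0) \<or> (\<forall>x\<ge>\<alpha>. poly g (of_real x) \<noteq> 0)"
proof -
  have h: "monic_of_degree n (q l)"
    unfolding q_def using f g by (rule monic_of_degree_convex)
  have "0 < Re (poly (q l) (of_real \<alpha>))"
  proof (rule poly_pos_beyond_roots[OF h, THEN conjunct2])
    fix z assume z: "poly (q l) z = 0"
    then have im: "Im z = 0"
      using real l by blast
    then have "z = of_real (Re z)"
      by (simp add: complex_eq_iff)
    then show "Im z = 0 \<and> Re z < \<alpha>"
      using ql[of "Re z"] z im by (metis not_le)
  qed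
  then have "0 < l * Re (poly f (of_real \<alpha>)) + (1 - l) * Re (poly g (of_real \<alpha>))"
    by (simp add: q_def)
  \<comment> \<open>A positive average forces one of the two values to be positive. That polynomial
    is then joined to \<open>q l\<close> by a segment inside the same family, which is real
    rooted.\<close>
  then consider "0 < Re (poly f (of_real \<alpha>))" | "0 < Re (poly g (of_real \<alpha>))"
    using l by (smt (verit) mult_nonneg_nonpos)
  moreover have l': "0 \<le> (1 - \<tau>) * l" "(1 - \<tau>) * l \<le> 1 - \<tau>" if "0 \<le> \<tau>" "\<tau> \<le> 1" for \<tau>
    using that l by (simp_all add: mult_left_le)
  ultimately show ?thesis
  proof cases
    case 1
    have eq: "smult (of_real \<tau>) f + smult (of_real (1 - \<tau>)) (q l) = q (\<tau> + (1 - \<tau>) * l)" for \<tau>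
      unfolding q_def by (intro poly_eqI) (simp add: algebra_simps)
    have "0 \<le> \<tau> + (1 - \<tau>) * l" "\<tau> + (1 - \<tau>) * l \<le> 1" if "0 \<le> \<tau>" "\<tau> \<le> 1" for \<tau>
      using that l'[OF that] by simp_all
    then have "poly f (of_real x) \<noteq> 0" if "\<alpha> \<le> x" for x
      by (intro no_root_along_segment[OF f h _ ql 1 that]) (unfold eq, erule real[rotated 2], simp_all)
    then show ?thesis
      by blast
  next
    case 2
    have eq: "smult (of_real \<tau>) g + smult (of_real (1 - \<tau>)) (q l) = q ((1 - \<tau>) * l)" for \<tau>
      unfolding q_def by (intro poly_eqI) (simp add: algebra_simps)
    have "0 \<le> (1 - \<tau>) * l" "(1 - \<tau>) * l \<le> 1" if "0 \<le> \<tau>" "\<tau> \<le> 1" for \<tau>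
      using that l'[OF that] by simp_all
    then have "poly g (of_real x) \<noteq> 0" if "\<alpha> \<le> x" for x
      by (intro no_root_along_segment[OF g h _ ql 2 that]) (unfold eq, erule real[rotated 2], simp_all)
    then show ?thesis
      by blast
  qed
qed

section \<open>Determinants as monic polynomials and the choice of an outcome\<close>

lemma rank1_update_diag_shift:
  "rank1_update (diag_shift x A) (of_real t) u = diag_shift x (rank1_update A t u)"
  by (simp add: vec_eq_iff)

lemma coeff_prod_linear:
  fixes a b :: "'i \<Rightarrow> 'a::comm_ring_1"
  assumes "finite S"
  shows "Polynomial.degree (\<Prod>i\<in>S. [:a i, b i:]) \<le> card S \<and> coeff (\<Prod>i\<in>S. [:a i, b i:]) (card S) = (\<Prod>i\<in>S. b i)"
  using assms
proof (induction S rule: finite_induct)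
  case (insert i S)
  let ?P = "\<Prod>i\<in>S. [:a i, b i:]"
  have "coeff ?P (Suc (card S)) = 0"
    using insert.IH by (intro coeff_eq_0) simp
  moreover have "Polynomial.degree ([:a i, b i:] * ?P) \<le> Suc (card S)"
  proof (rule order_trans[OF degree_mult_le])
    have "Polynomial.degree [:a i, b i:] \<le> 1"
      by simp
    then show "Polynomial.degree [:a i, b i:] + Polynomial.degree ?P \<le> Suc (card S)"
      using insert.IH by linarith
  qed
  ultimately show ?case
    using insert by (simp add: mult_pCons_left)
qed simp

text \<open>In the Leibniz expansion the coefficient of degree \<open>CARD('n)\<close> of each term
  is the corresponding term for the identity matrix, so the leading coefficient is
  \<open>det (mat 1)\<close>.\<close>

lemma det_diag_shift_poly:
  fixes A :: "real^'n^'n"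
  obtains p where "monic_of_degree CARD('n) p" "\<And>x. poly p x = det (diag_shift x A)"
proof -
  define M :: "complex poly^'n^'n" where
    "M = (\<chi> i j. [:of_real (A $ i $ j), if i = j then 1 else 0:])"
  let ?term = "\<lambda>\<pi>. of_int (sign \<pi>) * (\<Prod>i\<in>UNIV. M $ i $ \<pi> i)"
  have deg: "Polynomial.degree (\<Prod>i\<in>UNIV. M $ i $ \<pi> i) \<le> CARD('n)"
    and cf: "coeff (\<Prod>i\<in>UNIV. M $ i $ \<pi> i) CARD('n) = (\<Prod>i\<in>UNIV. (mat 1 :: complex^'n^'n) $ i $ \<pi> i)" for \<pi>
    using coeff_prod_linear[of "UNIV :: 'n set" "\<lambda>i. complex_of_real (A $ i $ \<pi> i)" "\<lambda>i. if i = \<pi> i then 1 else 0"]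
    by (simp_all add: M_def mat_def)
  have "monic_of_degree CARD('n) (det M)"
  proof (rule monic_of_degreeI)
    show "Polynomial.degree (det M) \<le> CARD('n)"
      unfolding det_def
    proof (rule degree_sum_le)
      show "Polynomial.degree (?term \<pi>) \<le> CARD('n)" for \<pi>
        using deg[of \<pi>] degree_mult_le[of "of_int (sign \<pi>)" "\<Prod>i\<in>UNIV. M $ i $ \<pi> i"] by simp
    qed simp
    have "coeff (det M) CARD('n) = (\<Sum>\<pi>\<in>{\<pi>. \<pi> permutes UNIV}. of_int (sign \<pi>) * (\<Prod>i\<in>UNIV. (mat 1 :: complex^'n^'n) $ i $ \<pi> i))"
      unfolding det_def coeff_sum
      by (intro sum.cong refl) (simp add: of_int_poly cf)
    also have "\<dots> = det (mat 1 :: complex^'n^'n)"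
      by (simp only: det_def)
    finally show "coeff (det M) CARD('n) = 1"
      by simp
  qed
  moreover have "poly (det M) x = det (diag_shift x A)" for x
  proof -
    have "poly (M $ i $ j) x = diag_shift x A $ i $ j" for i j
      by (simp add: M_def)
    then show ?thesis
      unfolding det_def by (simp add: poly_sum poly_prod del: diag_shift_nth)
  qed
  ultimately show thesis
    by (rule that)
qed

lemma mixed_det_poly:
  fixes A B :: "real^'n^'n"
  obtains p where "monic_of_degree (CARD('n) + CARD('n)) p"
    "\<And>x. poly p x = mixed_det r us (diag_shift x A) (diag_shift x B)"
proof (induction us arbitrary: A B thesis)
  case Nil
  obtain p where p: "monic_of_degree CARD('n) p" "\<And>x. poly p x = det (diag_shift x A)"
    by (rule det_diag_shift_poly[of A]) (rule that)
  obtain q where q: "monic_of_degree CARD('n) q" "\<And>x. poly q x = det (diag_shift x B)"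
    by (rule det_diag_shift_poly[of B]) (rule that)
  show ?case
    by (rule Nil[of "p * q"]) (simp_all add: p q monic_of_degree_mult)
next
  case (Cons u us)
  obtain p where p: "monic_of_degree (CARD('n) + CARD('n)) p"
    "\<And>x. poly p x = mixed_det r us (diag_shift x (rank1_update A (r - 1) u)) (diag_shift x (rank1_update B (- (r - 1)) u))"
    by (rule Cons.IH[where A = "rank1_update A (r - 1) u" and B = "rank1_update B (- (r - 1)) u"]) (rule that)
  obtain q where q: "monic_of_degree (CARD('n) + CARD('n)) q"
    "\<And>x. poly q x = mixed_det r us (diag_shift x (rank1_update A (- 1) u)) (diag_shift x (rank1_update B 1 u))"
    by (rule Cons.IH[where A = "rank1_update A (- 1) u" and B = "rank1_update B 1 u"]) (rule that)
  show ?case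
    using p(2) q(2)
    by (intro Cons.prems[OF monic_of_degree_convex[OF p(1) q(1), of "1 / r"]])
      (simp flip: rank1_update_diag_shift)
qed

lemma mixed_det_cnj:
  fixes A B :: "complex^'n^'n"
  shows "mixed_det r us (\<chi> i j. cnj (A $ i $ j)) (\<chi> i j. cnj (B $ i $ j)) = cnj (mixed_det r us A B)"
proof (induction us arbitrary: A B)
  case Nil
  have "det (\<chi> i j. cnj (A $ i $ j)) = cnj (det A)" for A :: "complex^'n^'n"
    by (simp add: det_def)
  then show ?case by simp
next
  case (Cons u us)
  have "rank1_update (\<chi> i j. cnj (A $ i $ j)) (of_real (r - 1)) u = (\<chi> i j. cnj (rank1_update A (of_real (r - 1)) u $ i $ j))"
    "rank1_update (\<chi> i j. cnj (A $ i $ j)) (- of_real (r - 1)) u = (\<chi> i j. cnj (rank1_update A (- of_real (r - 1)) u $ i $ j))"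
    "rank1_update (\<chi> i j. cnj (A $ i $ j)) (- 1) u = (\<chi> i j. cnj (rank1_update A (- 1) u $ i $ j))"
    "rank1_update (\<chi> i j. cnj (A $ i $ j)) 1 u = (\<chi> i j. cnj (rank1_update A 1 u $ i $ j))"
    for A :: "complex^'n^'n"
    by (simp_all add: vec_eq_iff)
  then show ?case
    by (simp only: mixed_det.simps Cons.IH complex_cnj_add complex_cnj_mult complex_cnj_complex_of_real)
qed

text \<open>Stability excludes zeros in the open upper half plane, and conjugation reflects this to
  the lower one because \<open>A\<close> and \<open>B\<close> are real. The weight \<open>l\<close>
  is arbitrary since the interlacing step needs every convex combination, not only the one with
  weight \<open>1 / r\<close>.\<close>

lemma mixed_det_average_real_roots:
  fixes A B :: "real^'n^'n"
  assumes "1 \<le> r" and sym: "transpose A = A" "transpose B = B" and l: "0 \<le> l" "l \<le> 1"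
    and zero: "of_real l * mixed_det r us (diag_shift z (rank1_update A a u)) (diag_shift z (rank1_update B (- a) u))
    + of_real (1 - l) * mixed_det r us (diag_shift z (rank1_update A b u)) (diag_shift z (rank1_update B (- b) u)) = 0"
  shows "Im z = 0"
proof -
  define F where "F z = of_real l * mixed_det r us (diag_shift z (rank1_update A a u)) (diag_shift z (rank1_update B (- a) u))
    + of_real (1 - l) * mixed_det r us (diag_shift z (rank1_update A b u)) (diag_shift z (rank1_update B (- b) u))" for z
  have upper: "F z \<noteq> 0" if "0 < Im z" for z
    using mixed_det_average_nonzero[of r us "diag_shift z A" "diag_shift z B" l a u b,
        OF mixed_det_nonzero[OF \<open>1 \<le> r\<close>]]
      pos_imag_diag_shift[OF sym(1) that] pos_imag_diag_shift[OF sym(2) that] l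
    by (simp add: F_def rank1_update_diag_shift flip: of_real_minus)
  have "diag_shift (cnj z) A = (\<chi> i j. cnj (diag_shift z A $ i $ j))" for A :: "real^'n^'n"
    by (auto simp: vec_eq_iff)
  then have "F (cnj z) = cnj (F z)"
    by (simp only: F_def mixed_det_cnj complex_cnj_add complex_cnj_mult complex_cnj_complex_of_real)
  then show ?thesis
    using upper[of z] upper[of "cnj z"] zero[folded F_def] by (cases "Im z" "0 :: real" rule: linorder_cases) auto
qed

text \<open>The weights are fixed one after another. At each stage the current polynomial is a
  convex combination of the two conditional ones, and interlacing passes the absence of large roots
  to at least one of them. \<open>M\<close> is the resulting matrix, recorded through its quadratic
  form.\<close>

lemma exists_outcome_without_large_roots:
  fixes A :: "real^'n^'n"
  assumes "1 \<le> r" "transpose A = A"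
    and "\<And>x. \<alpha> \<le> x \<Longrightarrow> mixed_det r us (diag_shift (of_real x) A) (diag_shift (of_real x) (- A)) \<noteq> 0"
  shows "\<exists>ys M. length ys = length us \<and> set ys \<subseteq> {r - 1, - 1} \<and> transpose M = M \<and>
    (\<forall>p. quad_form M p = quad_form A p + (\<Sum>(y, u)\<leftarrow>zip ys us. y * (u \<bullet> p)\<^sup>2)) \<and>
    (\<forall>x\<ge>\<alpha>. det (diag_shift (of_real x) M) * det (diag_shift (of_real x) (- M)) \<noteq> 0)"
  using assms(2,3)
proof (induction us arbitrary: A)
  case Nil
  then show ?case
    by (intro exI[of _ "[]"] exI[of _ A]) simp
next
  case (Cons u us)
  have neg: "- rank1_update A t u = rank1_update (- A) (- t) u" for t
    by (simp add: vec_eq_iff)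
  obtain f where f: "monic_of_degree (CARD('n) + CARD('n)) f"
    "\<And>x. poly f x = mixed_det r us (diag_shift x (rank1_update A (r - 1) u)) (diag_shift x (- rank1_update A (r - 1) u))"
    by (rule mixed_det_poly[where r = r and us = us and A = "rank1_update A (r - 1) u" and B = "- rank1_update A (r - 1) u"]) (rule that)
  obtain g where g: "monic_of_degree (CARD('n) + CARD('n)) g"
    "\<And>x. poly g x = mixed_det r us (diag_shift x (rank1_update A (- 1) u)) (diag_shift x (- rank1_update A (- 1) u))"
    by (rule mixed_det_poly[where r = r and us = us and A = "rank1_update A (- 1) u" and B = "- rank1_update A (- 1) u"]) (rule that)
  have sym: "transpose (- A) = - A"
    using Cons.prems(1) by (simp add: vec_eq_iff transpose_def)
  have alt: "(\<forall>x\<ge>\<alpha>. poly f (of_real x) \<noteq> 0) \<or> (\<forall>x\<ge>\<alpha>. poly g (of_real x) \<noteq> 0)"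
  proof (rule no_root_of_convex_combination[OF f(1) g(1)])
    show "Im z = 0" if "0 \<le> \<tau>" "\<tau> \<le> 1"
      "poly (smult (of_real \<tau>) f + smult (of_real (1 - \<tau>)) g) z = 0" for \<tau> z
      using that mixed_det_average_real_roots[OF assms(1) Cons.prems(1) sym that(1,2), of us z "r - 1" u "- 1"]
      by (simp add: f g neg)
    show "0 \<le> 1 / r" "1 / r \<le> 1"
      using assms(1) by simp_all
    show "poly (smult (of_real (1 / r)) f + smult (of_real (1 - 1 / r)) g) (of_real x) \<noteq> 0" if "\<alpha> \<le> x" for x
      using Cons.prems(2)[OF that] by (simp add: f g neg flip: rank1_update_diag_shift)
  qed
  have step: ?case if y: "y \<in> {r - 1, - 1}"
    "\<forall>x\<ge>\<alpha>. mixed_det r us (diag_shift (of_real x) (rank1_update A y u)) (diag_shift (of_real x) (- rank1_update A y u)) \<noteq> 0" for y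
  proof -
    obtain ys M where M: "length ys = length us" "set ys \<subseteq> {r - 1, - 1}" "transpose M = M"
      "\<And>p. quad_form M p = quad_form (rank1_update A y u) p + (\<Sum>(y, u)\<leftarrow>zip ys us. y * (u \<bullet> p)\<^sup>2)"
      "\<forall>x\<ge>\<alpha>. det (diag_shift (of_real x) M) * det (diag_shift (of_real x) (- M)) \<noteq> 0"
      using Cons.IH[OF transpose_rank1_update[OF Cons.prems(1)], of y u] y(2) by blast
    show ?thesis
      by (rule exI[of _ "y # ys"], rule exI[of _ M]) (use M y(1) in \<open>auto simp: quad_form_rank1_update\<close>)
  qed
  from alt show ?case
    using step[of "r - 1"] step[of "- 1"] by (auto simp: f g)
qed

text \<open>The maximum \<open>l\<close> of the form on the unit sphere is an eigenvalue. If it were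
  at least \<alpha>, it would be a forbidden zero of the determinant.\<close>

lemma quad_form_le_if_no_large_eigenvalue:
  fixes M :: "real^'n^'n"
  assumes sym: "transpose M = M" and nz: "\<And>x. \<alpha> \<le> x \<Longrightarrow> det (diag_shift (of_real x) (- M)) \<noteq> 0"
  shows "quad_form M p \<le> \<alpha> * (p \<bullet> p)"
proof -
  have cont: "continuous_on (sphere 0 1) (quad_form M)"
    unfolding quad_form_def by (intro continuous_intros) 
  obtain i :: 'n where True by simp
  have "axis i 1 \<in> sphere (0 :: real^'n) 1"
    by simp
  then obtain v where v: "v \<in> sphere 0 1" and max: "\<And>x. x \<in> sphere 0 1 \<Longrightarrow> quad_form M x \<le> quad_form M v"
    using continuous_attains_sup[OF compact_sphere _ cont] by blast
  define l where "l = quad_form M v"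
  have le: "quad_form M x \<le> l * (x \<bullet> x)" for x
  proof (cases "x = 0")
    case False
    have "quad_form M x = (norm x)\<^sup>2 * quad_form M ((1 / norm x) *\<^sub>R x)"
      using False by (simp add: quad_form_eq_inner matrix_vector_mult_scaleR power2_eq_square)
    also have "\<dots> \<le> (norm x)\<^sup>2 * l"
      unfolding l_def using False by (intro mult_left_mono max) simp_all
    finally show ?thesis
      by (simp add: power2_norm_eq_inner mult.commute)
  qed (simp add: quad_form_def)
  have "l < \<alpha>"
  proof (rule ccontr)
    assume "\<not> l < \<alpha>"
    define z where "z = M *v v - l *\<^sub>R v"
    have vv: "v \<bullet> v = 1"
      using v by (simp add: norm_eq_1)
    have Msym: "x \<bullet> (M *v y) = y \<bullet> (M *v x)" for x y
      by (metis dot_lmul_matrix inner_commute sym transpose_matrix_vector)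
    \<comment> \<open>First-order optimality of \<open>v\<close>, tested in the direction of its own
      residual \<open>z\<close>: the linear term is \<open>2 * (z \<bullet> z)\<close>, so
      \<open>z\<close> must vanish.\<close>
    have "2 * (z \<bullet> z) * t + (z \<bullet> (M *v z) - l * (z \<bullet> z)) * t\<^sup>2 \<le> 0 * t" if "0 < t" for t
    proof -
      have "quad_form M (v + t *\<^sub>R z) = quad_form M v + 2 * t * (z \<bullet> (M *v v)) + t\<^sup>2 * (z \<bullet> (M *v z))"
        using Msym[of v z]
        by (simp add: quad_form_eq_inner matrix_vector_right_distrib matrix_vector_mult_scaleR
            inner_add_left inner_add_right power2_eq_square algebra_simps)
      moreover have "l * ((v + t *\<^sub>R z) \<bullet> (v + t *\<^sub>R z)) = l + 2 * t * (l * (z \<bullet> v)) + t\<^sup>2 * (l * (z \<bullet> z))"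
        using vv inner_commute[of v z] by (simp add: inner_add_left inner_add_right power2_eq_square algebra_simps)
      ultimately have "2 * t * (z \<bullet> (M *v v)) + t\<^sup>2 * (z \<bullet> (M *v z))
          \<le> 2 * t * (l * (z \<bullet> v)) + t\<^sup>2 * (l * (z \<bullet> z))"
        using le[of "v + t *\<^sub>R z"] l_def by simp
      moreover have "z \<bullet> z = z \<bullet> (M *v v) - l * (z \<bullet> v)"
        using inner_diff_right[of z "M *v v" "l *\<^sub>R v"] by (simp add: z_def)
      then have "2 * (z \<bullet> z) * t = 2 * t * (z \<bullet> (M *v v)) - 2 * t * (l * (z \<bullet> v))"
        by (simp only:) (simp add: algebra_simps)
      ultimately show ?thesis
        by (simp add: algebra_simps)
    qed
    then have "2 * (z \<bullet> z) \<le> 0"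
      by (rule linear_coeff_le)
    then have "z = 0"
      by (metis inner_eq_zero_iff inner_ge_zero mult_le_0_iff not_numeral_le_zero order_antisym)
    define B where "B = (\<chi> i j. (- M) $ i $ j + (if i = j then l else 0))"
    have "B *v v = l *\<^sub>R v - M *v v"
      by (simp add: B_def vec_eq_iff matrix_vector_mult_def left_diff_distrib sum_subtractf
          if_distrib[of "\<lambda>x. x * _"] cong: if_cong)
    then have "B *v v = 0"
      using \<open>z = 0\<close> by (simp add: z_def)
    moreover have "v \<noteq> 0"
      using vv by auto
    ultimately have "det B = 0"
      using invertible_det_nz[of B] by (auto simp: invertible_left_inverse matrix_left_invertible_ker)
    moreover have "diag_shift (of_real l) (- M) = of_real_mat B"
      by (simp add: vec_eq_iff B_def)
    ultimately have "det (diag_shift (of_real l) (- M)) = 0"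
      by (simp add: det_of_real_mat)
    then show False
      using nz[of l] \<open>\<not> l < \<alpha>\<close> by simp
  qed
  then have "l * (p \<bullet> p) \<le> \<alpha> * (p \<bullet> p)"
    by (intro mult_right_mono) simp_all
  with le[of p] show ?thesis
    by simp
qed

text \<open>Kyng, Luh and Song prove this with the constant 4 instead of 3, for general independent
  weights.\<close>

theorem rank_one_discrepancy:
  fixes us :: "(real^'n) list"
  assumes r: "1 < r" and V: "0 < V" and nonzero: "\<And>u. u \<in> set us \<Longrightarrow> u \<noteq> 0"
    and var: "\<And>p. (r - 1) * (\<Sum>u\<leftarrow>us. (u \<bullet> u) * (u \<bullet> p)\<^sup>2) \<le> V * (p \<bullet> p)"
  shows "\<exists>ys. length ys = length us \<and> set ys \<subseteq> {r - 1, - 1} \<and>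
    (\<forall>p. \<bar>\<Sum>(y, u)\<leftarrow>zip ys us. y * (u \<bullet> p)\<^sup>2\<bar> \<le> 3 * sqrt V * (p \<bullet> p))"
proof -
  \<comment> \<open>At \<open>x = 3 * sqrt V\<close> the shifts lower the form by at most
    \<open>k * V = sqrt V\<close>, and exactly the required margin \<open>2 / k = 2 * sqrt V\<close>
    is left.\<close>
  define k where "k = 1 / sqrt V"
  have k: "0 < k" "k * V = sqrt V" "2 / k = 2 * sqrt V" "k\<^sup>2 = 1 / V"
    using V by (simp_all add: k_def field_simps)
  have small: "u \<noteq> 0 \<and> (r - 1) * (k * (u \<bullet> u))\<^sup>2 \<le> 1" if u: "u \<in> set us" for u
  proof -
    \<comment> \<open>The variance hypothesis at \<open>p = u\<close>, keeping only the summand of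
      \<open>u\<close>, bounds the individual length of \<open>u\<close>.\<close>
    have "(u \<bullet> u) * (u \<bullet> u)\<^sup>2 \<le> (\<Sum>w\<leftarrow>us. (w \<bullet> w) * (w \<bullet> u)\<^sup>2)"
      using u by (intro member_le_sum_list) auto
    then have "(r - 1) * ((u \<bullet> u) * (u \<bullet> u)\<^sup>2) \<le> V * (u \<bullet> u)"
      using var[of u] r mult_left_mono by (smt (verit))
    then have "((r - 1) * (u \<bullet> u)\<^sup>2) * (u \<bullet> u) \<le> V * (u \<bullet> u)"
      by (simp add: mult_ac)
    then have "(r - 1) * (u \<bullet> u)\<^sup>2 \<le> V"
      using nonzero[OF u] by simp
    then show ?thesis
      using nonzero[OF u] V by (simp add: power_mult_distrib k)
  qed
  let ?I = "\<lambda>x. (\<chi> i j. if i = j then x else 0) :: real^'n^'n"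
  have "0 < mixed_det r us (?I x) (?I x)" if x: "3 * sqrt V \<le> x" for x
  proof -
    have "transpose (?I x) = ?I x"
      by (auto simp: transpose_def vec_eq_iff)
    moreover have "2 / k * (p \<bullet> p) \<le> quad_form (barrier_shift ((r - 1) * k) us (?I x)) p" for p
    proof -
      have "quad_form (?I x) p = x * (p \<bullet> p)"
        by (simp add: quad_form_def inner_vec_def sum_distrib_left if_distrib[of "\<lambda>y. y * _"] cong: if_cong)
      moreover have "k * ((r - 1) * (\<Sum>u\<leftarrow>us. (u \<bullet> u) * (u \<bullet> p)\<^sup>2)) \<le> k * (V * (p \<bullet> p))"
        using var[of p] k by (intro mult_left_mono) auto
      moreover have "k * (V * (p \<bullet> p)) = sqrt V * (p \<bullet> p)"
        using k(2) by (metis mult.assoc)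
      moreover have "3 * (sqrt V * (p \<bullet> p)) \<le> x * (p \<bullet> p)"
        using x unfolding mult.assoc[symmetric] by (intro mult_right_mono) auto
      moreover have "(r - 1) * k * (\<Sum>u\<leftarrow>us. (u \<bullet> u) * (u \<bullet> p)\<^sup>2)
          = k * ((r - 1) * (\<Sum>u\<leftarrow>us. (u \<bullet> u) * (u \<bullet> p)\<^sup>2))"
        by (simp only: mult_ac)
      ultimately show ?thesis
        unfolding quad_form_barrier_shift k(3) mult.assoc[of 2] by linarith
    qed
    ultimately show ?thesis
      using mixed_det_barrier[OF r k(1) small, of us "?I x"] by blast
  qed
  moreover have "diag_shift (of_real x) 0 = of_real_mat (?I x)" "diag_shift (of_real x) (- 0) = of_real_mat (?I x)" for x
    by (simp_all add: vec_eq_iff)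
  ultimately have "mixed_det r us (diag_shift (of_real x) 0) (diag_shift (of_real x) (- 0)) \<noteq> 0"
    if "3 * sqrt V \<le> x" for x
    using that by (simp only: mixed_det_of_real_mat of_real_eq_0_iff) force
  moreover have "transpose (0 :: real^'n^'n) = 0"
    by (simp add: vec_eq_iff transpose_def)
  ultimately obtain ys M where M: "length ys = length us" "set ys \<subseteq> {r - 1, - 1}" "transpose M = M"
      "\<And>p. quad_form M p = quad_form 0 p + (\<Sum>(y, u)\<leftarrow>zip ys us. y * (u \<bullet> p)\<^sup>2)"
      "\<forall>x\<ge>3 * sqrt V. det (diag_shift (of_real x) M) * det (diag_shift (of_real x) (- M)) \<noteq> 0"
    using exists_outcome_without_large_roots[of r 0 "3 * sqrt V" us] r by force
  have "\<bar>\<Sum>(y, u)\<leftarrow>zip ys us. y * (u \<bullet> p)\<^sup>2\<bar> \<le> 3 * sqrt V * (p \<bullet> p)" for p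
  proof -
    have "quad_form M p = (\<Sum>(y, u)\<leftarrow>zip ys us. y * (u \<bullet> p)\<^sup>2)"
      using M(4)[of p] by (simp add: quad_form_def)
    moreover have "quad_form M p \<le> 3 * sqrt V * (p \<bullet> p)"
      using M(3,5) by (intro quad_form_le_if_no_large_eigenvalue) auto
    moreover have "transpose (- M) = - M"
      using M(3) by (simp add: vec_eq_iff transpose_def)
    then have "quad_form (- M) p \<le> 3 * sqrt V * (p \<bullet> p)"
      using M(5) by (intro quad_form_le_if_no_large_eigenvalue) auto
    moreover have "quad_form (- M) p = - quad_form M p"
      by (simp add: quad_form_def sum_negf)
    ultimately show ?thesis
      by simp
  qed
  with M(1,2) show ?thesis
    by blast
qed

section \<open>Graphs\<close>

lemma quad_form_outer: "quad_form (outer b) x = (b \<bullet> x)\<^sup>2"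
proof -
  have "(b \<bullet> x)\<^sup>2 = (\<Sum>i\<in>UNIV. \<Sum>j\<in>UNIV. (b $ i * x $ i) * (b $ j * x $ j))"
    unfolding power2_eq_square inner_vec_def sum_product by simp
  then show ?thesis
    by (simp add: quad_form_def outer_def mult_ac)
qed

lemma quad_form_sum: "quad_form (\<Sum>e\<in>S. A e) x = (\<Sum>e\<in>S. quad_form (A e) x)" for A :: "'e \<Rightarrow> real^'v^'v"
  by (induction S rule: infinite_finite_induct) (simp_all add: quad_form_eq_inner matrix_vector_mult_add_rdistrib inner_add_right)

lemma quad_form_diff: "quad_form (A - B) x = quad_form A x - quad_form B x" for A B :: "real^'v^'v"
  by (simp add: quad_form_def left_diff_distrib sum_subtractf)

lemma quad_form_scaleR: "quad_form (c *\<^sub>R A) x = c * quad_form A x" for A :: "real^'v^'v"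
  by (simp add: quad_form_def sum_distrib_left mult.assoc)

lemma quad_form_mat: "quad_form (mat 1) x = x \<bullet> x" for x :: "real^'v"
  by (simp add: quad_form_eq_inner)

lemma psd_le_bounds:
  fixes X :: "real^'v^'v"
  assumes sym: "transpose X = X" and bound: "\<And>x. \<bar>quad_form X x\<bar> \<le> c * (x \<bullet> x)"
  shows "(- c) *\<^sub>R mat 1 \<preceq> X" "X \<preceq> c *\<^sub>R mat 1"
proof -
  have "X $ j $ i = X $ i $ j" for i j
    using sym unfolding transpose_def vec_eq_iff by simp
  then have "transpose (X - (- c) *\<^sub>R mat 1) = X - (- c) *\<^sub>R mat 1"
    "transpose (c *\<^sub>R mat 1 - X) = c *\<^sub>R mat 1 - X"
    by (simp_all add: vec_eq_iff transpose_def mat_def)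
  moreover have "0 \<le> quad_form (X - (- c) *\<^sub>R mat 1) x" "0 \<le> quad_form (c *\<^sub>R mat 1 - X) x" for x
    using bound[of x] unfolding quad_form_diff quad_form_scaleR quad_form_mat by linarith+
  ultimately show "(- c) *\<^sub>R mat 1 \<preceq> X" "X \<preceq> c *\<^sub>R mat 1"
    unfolding psd_le_def psd_def quad_form_eq_inner by blast+
qed

text \<open>The sign of \<open>edge_vec\<close> depends on an arbitrary choice. Quantities blind to
  it are read off from the outer product, which does not.\<close>

lemma edge_vec_inner:
  assumes "u \<noteq> v"
  shows "(edge_vec {u, v} \<bullet> x)\<^sup>2 = (x $ u - x $ v)\<^sup>2" "edge_vec {u, v} \<bullet> edge_vec {u, v} = 2"
proof -
  have eq: "outer (edge_vec {u, v}) = outer (axis u 1 - axis v 1)"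
    using edge_matrix_doubleton[of u v] by (simp add: edge_matrix_def)
  show "(edge_vec {u, v} \<bullet> x)\<^sup>2 = (x $ u - x $ v)\<^sup>2"
    unfolding quad_form_outer[symmetric] eq
    by (simp add: quad_form_outer inner_diff_left inner_axis')
  have "b \<bullet> b = (\<Sum>i\<in>UNIV. outer b $ i $ i)" for b :: "real^'a"
    by (simp add: outer_def inner_vec_def)
  then have "edge_vec {u, v} \<bullet> edge_vec {u, v} = (axis u 1 - axis v 1) \<bullet> (axis u 1 - axis v 1 :: real^'a)"
    by (simp only: eq)
  also have "\<dots> = 2"
    using assms by (simp add: inner_diff_left inner_diff_right inner_axis_axis)
  finally show "edge_vec {u, v} \<bullet> edge_vec {u, v} = 2" .
qed

lemma sum_over_edges:
  fixes E :: "'v::finite set set" and g :: "'v \<Rightarrow> real"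
  shows "(\<Sum>e\<in>E. \<Sum>v\<in>e. g v) = (\<Sum>v\<in>UNIV. Defs.degree E v * g v)"
proof -
  have "(\<Sum>e\<in>E. \<Sum>v\<in>e. g v) = (\<Sum>e\<in>E. \<Sum>v | v \<in> UNIV \<and> v \<in> e. g v)"
    by simp
  also have "\<dots> = (\<Sum>v\<in>UNIV. \<Sum>e | e \<in> E \<and> v \<in> e. g v)"
    by (rule sum.swap_restrict) auto
  also have "\<dots> = (\<Sum>v\<in>UNIV. Defs.degree E v * g v)"
    by (simp add: Defs.degree_def)
  finally show ?thesis .
qed

lemma degree_le_max_degree: "Defs.degree E v \<le> max_degree E"
  unfolding max_degree_def by (rule Max_ge) auto

lemma max_degree_le_card: "max_degree E \<le> card E" for E :: "'v::finite set set"
  unfolding max_degree_def by (subst Max_le_iff) (auto simp: Defs.degree_def intro: card_mono)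

lemma twice_card_edges_le:
  fixes E :: "'v::finite set set"
  assumes "simple_graph E"
  shows "2 * card E \<le> CARD('v) * max_degree E"
proof -
  have "card e = 2" if "e \<in> E" for e
    using assms that by (auto simp: simple_graph_def)
  then have "2 * real (card E) = (\<Sum>e\<in>E. \<Sum>v\<in>e. 1)"
    by simp
  also have "\<dots> \<le> (\<Sum>v\<in>(UNIV :: 'v set). real (max_degree E))"
    unfolding sum_over_edges by (intro sum_mono) (simp add: degree_le_max_degree)
  finally have "real (2 * card E) \<le> real (CARD('v) * max_degree E)"
    by simp
  then show ?thesis
    by (simp only: of_nat_le_iff)
qed

text \<open>The Laplacian is at most twice the maximum degree: bound each edge by (x_u - x_v)^2
  \<le> 2 x_u^2 + 2 x_v^2 and count every vertex once per incident edge.\<close>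

lemma sum_edge_vec_le:
  fixes E :: "'v::finite set set"
  assumes "simple_graph E"
  shows "(\<Sum>e\<in>E. (edge_vec e \<bullet> x)\<^sup>2) \<le> 2 * max_degree E * (x \<bullet> x)"
proof -
  have "(edge_vec e \<bullet> x)\<^sup>2 \<le> (\<Sum>v\<in>e. 2 * (x $ v)\<^sup>2)" if e: "e \<in> E" for e
  proof -
    obtain u v where uv: "u \<noteq> v" "e = {u, v}"
      using assms[unfolded simple_graph_def, rule_format, OF e] by auto
    have "(x $ u - x $ v)\<^sup>2 \<le> 2 * (x $ u)\<^sup>2 + 2 * (x $ v)\<^sup>2"
      using zero_le_power2[of "x $ u + x $ v"] by (simp add: power2_eq_square algebra_simps)
    then show ?thesis
      using uv by (simp add: edge_vec_inner)
  qed
  then have "(\<Sum>e\<in>E. (edge_vec e \<bullet> x)\<^sup>2) \<le> (\<Sum>e\<in>E. \<Sum>v\<in>e. 2 * (x $ v)\<^sup>2)"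
    by (rule sum_mono)
  also have "\<dots> \<le> (\<Sum>v\<in>UNIV. max_degree E * (2 * (x $ v)\<^sup>2))"
    unfolding sum_over_edges by (intro sum_mono mult_right_mono) (simp_all add: degree_le_max_degree)
  also have "\<dots> = 2 * max_degree E * (x \<bullet> x)"
    by (simp add: inner_vec_def sum_distrib_left power2_eq_square mult_ac)
  finally show ?thesis .
qed

section \<open>Edge vectors with one extra coordinate\<close>

definition extend_vec :: "real^'v \<Rightarrow> real \<Rightarrow> real^('v option)" where
  "extend_vec x z = (\<chi> i. case i of None \<Rightarrow> z | Some v \<Rightarrow> x $ v)"

lemma extend_vec_inner: "extend_vec x z \<bullet> extend_vec y w = z * w + x \<bullet> y" for x :: "real^'v::finite"
  by (simp add: extend_vec_def inner_vec_def UNIV_option_conv sum.reindex)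

lemma extend_vec_cases:
  fixes p :: "real^('v::finite option)"
  obtains x z where "p = extend_vec x z"
proof
  show "p = extend_vec (\<chi> v. p $ Some v) (p $ None)"
    by (auto simp: extend_vec_def vec_eq_iff split: option.split)
qed

lemma exists_map_of_length_eq:
  assumes "distinct xs" "length ys = length xs"
  shows "\<exists>f. ys = map f xs"
  using assms
  by (intro exI[of _ "\<lambda>x. the (map_of (zip xs ys) x)"] nth_equalityI) (simp_all add: map_of_zip_nth)

text \<open>The extra coordinate of the vectors controls the cardinality of the chosen set of edges.\<close>

lemma exists_edge_subset:
  fixes E :: "'v::finite set set"
  assumes graph: "simple_graph E" and s: "1 < s" and "E \<noteq> {}"
  defines "m \<equiv> real (card E)" and "d \<equiv> real (max_degree E)"
  shows "\<exists>F\<subseteq>E. (\<forall>x. \<bar>(\<Sum>e\<in>E. (edge_vec e \<bullet> x)\<^sup>2) - s * (\<Sum>e\<in>F. (edge_vec e \<bullet> x)\<^sup>2)\<bar> \<le> 12 * sqrt (s * d) * (x \<bullet> x))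
    \<and> 2 * d / m * \<bar>m - s * card F\<bar> \<le> 12 * sqrt (s * d)"
proof -
  have "0 < m"
    using \<open>E \<noteq> {}\<close> by (simp add: m_def card_gt_0_iff)
  have "2 * m \<le> CARD('v) * d"
    using of_nat_mono[OF twice_card_edges_le[OF graph], where 'a = real] by (simp add: m_def d_def)
  then have "0 < d"
    using \<open>0 < m\<close> by (smt (verit) d_def mult_nonneg_nonpos of_nat_0_le_iff)
  have "d \<le> m"
    using max_degree_le_card[of E] by (simp add: d_def m_def)
  \<comment> \<open>With \<open>c\<^sup>2 * m = 2 * d\<close> the extra coordinate has the same
    total weight \<open>2 * d\<close> as the bound for the edge vectors. As
    \<open>d \<le> m\<close>, it also keeps \<open>w e \<bullet> w e\<close> at most 4.\<close>
  define c where "c = sqrt (2 * d / m)"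
  have c: "c\<^sup>2 = 2 * d / m" "c\<^sup>2 \<le> 2" "c\<^sup>2 * m = 2 * d"
    using \<open>0 < m\<close> \<open>0 < d\<close> \<open>d \<le> m\<close> by (simp_all add: c_def field_simps)
  define w where "w e = extend_vec (edge_vec e) c" for e :: "'v set"
  have ww: "w e \<bullet> w e = c\<^sup>2 + 2" if e: "e \<in> E" for e
  proof -
    obtain u v where "u \<noteq> v" "e = {u, v}"
      using graph[unfolded simple_graph_def, rule_format, OF e] by auto
    then show ?thesis
      by (simp add: w_def extend_vec_inner edge_vec_inner power2_eq_square)
  qed
  obtain es where es: "set es = E" "distinct es"
    using finite_distinct_list[of E] by auto
  have sum_es: "(\<Sum>e\<leftarrow>es. g e) = (\<Sum>e\<in>E. g e)" for g :: "'v set \<Rightarrow> real"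
    using es by (simp add: sum_list_distinct_conv_sum_set)
  \<comment> \<open>The 16 is 4 * 4: one factor bounds \<open>w e \<bullet> w e\<close>; the other
    comes from \<open>2 * d\<close>, doubled when the square of the sum of the two coordinates'
    contributions is split.\<close>
  have var: "(s - 1) * (\<Sum>u\<leftarrow>map w es. (u \<bullet> u) * (u \<bullet> p)\<^sup>2) \<le> (16 * (s * d)) * (p \<bullet> p)" for p
  proof -
    obtain x z where p: "p = extend_vec x z"
      by (rule extend_vec_cases)
    have "(w e \<bullet> p)\<^sup>2 \<le> 2 * (edge_vec e \<bullet> x)\<^sup>2 + 2 * (c\<^sup>2 * z\<^sup>2)" for e
      using zero_le_power2[of "c * z - edge_vec e \<bullet> x"]
      by (simp add: w_def p extend_vec_inner power2_eq_square algebra_simps)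
    then have "(\<Sum>e\<in>E. (w e \<bullet> p)\<^sup>2) \<le> (\<Sum>e\<in>E. 2 * (edge_vec e \<bullet> x)\<^sup>2 + 2 * (c\<^sup>2 * z\<^sup>2))"
      by (intro sum_mono)
    also have "\<dots> = 2 * (\<Sum>e\<in>E. (edge_vec e \<bullet> x)\<^sup>2) + 2 * ((c\<^sup>2 * m) * z\<^sup>2)"
      by (simp add: sum.distrib sum_distrib_left m_def)
    also have "\<dots> \<le> 2 * (2 * d * (x \<bullet> x)) + 2 * (2 * d * z\<^sup>2)"
      unfolding c(3) d_def using sum_edge_vec_le[OF graph, of x] by linarith
    also have "\<dots> = 4 * d * (p \<bullet> p)"
      by (simp add: p extend_vec_inner power2_eq_square algebra_simps)
    finally have le: "(\<Sum>e\<in>E. (w e \<bullet> p)\<^sup>2) \<le> 4 * d * (p \<bullet> p)" .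
    have "(s - 1) * (\<Sum>u\<leftarrow>map w es. (u \<bullet> u) * (u \<bullet> p)\<^sup>2) = ((s - 1) * (c\<^sup>2 + 2)) * (\<Sum>e\<in>E. (w e \<bullet> p)\<^sup>2)"
      by (simp add: sum_es ww sum_distrib_left mult_ac o_def)
    also have "\<dots> \<le> (s * 4) * (4 * d * (p \<bullet> p))"
      using s c(2) le by (intro mult_mono) (auto simp: sum_nonneg)
    finally show ?thesis
      by (simp add: mult_ac)
  qed
  have "w e \<noteq> 0" if "e \<in> E" for e
    using ww[OF that] by (auto simp: add_nonneg_eq_0_iff)
  then obtain ys where ys: "length ys = length (map w es)" "set ys \<subseteq> {s - 1, - 1}"
    and bound: "\<And>p. \<bar>\<Sum>(y, u)\<leftarrow>zip ys (map w es). y * (u \<bullet> p)\<^sup>2\<bar> \<le> 3 * sqrt (16 * (s * d)) * (p \<bullet> p)"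
    using rank_one_discrepancy[OF s _ _ var] s \<open>0 < d\<close> es(1) by force
  obtain f where f: "ys = map f es"
    using exists_map_of_length_eq[OF es(2)] ys(1) by auto
  define F where "F = {e \<in> E. f e = s - 1}"
  have "F \<subseteq> E"
    by (auto simp: F_def)
  have f_eq: "f e = s * (if e \<in> F then 1 else 0) - 1" if "e \<in> E" for e
    using ys(2) that es(1) f by (auto simp: F_def)
  have total: "(\<Sum>(y, u)\<leftarrow>zip ys (map w es). y * (u \<bullet> p)\<^sup>2) = s * (\<Sum>e\<in>F. (w e \<bullet> p)\<^sup>2) - (\<Sum>e\<in>E. (w e \<bullet> p)\<^sup>2)" for p
  proof -
    have "zip ys (map w es) = map (\<lambda>e. (f e, w e)) es"
      unfolding f by (simp add: zip_map_map zip_same_conv_map)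
    then have "(\<Sum>(y, u)\<leftarrow>zip ys (map w es). y * (u \<bullet> p)\<^sup>2) = (\<Sum>e\<in>E. f e * (w e \<bullet> p)\<^sup>2)"
      by (simp add: sum_es o_def)
    also have "\<dots> = (\<Sum>e\<in>E. s * (if e \<in> F then (w e \<bullet> p)\<^sup>2 else 0) - (w e \<bullet> p)\<^sup>2)"
      by (intro sum.cong refl) (simp add: f_eq left_diff_distrib)
    also have "\<dots> = s * (\<Sum>e\<in>E. if e \<in> F then (w e \<bullet> p)\<^sup>2 else 0) - (\<Sum>e\<in>E. (w e \<bullet> p)\<^sup>2)"
      by (simp add: sum_subtractf sum_distrib_left)
    also have "(\<Sum>e\<in>E. if e \<in> F then (w e \<bullet> p)\<^sup>2 else 0) = (\<Sum>e\<in>F. (w e \<bullet> p)\<^sup>2)"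
      using \<open>F \<subseteq> E\<close> by (simp add: sum.inter_restrict[symmetric] Int_absorb1)
    finally show ?thesis .
  qed
  have sqrt16: "3 * sqrt (16 * (s * d)) = 12 * sqrt (s * d)"
    by (simp add: real_sqrt_mult)
  \<comment> \<open>Test vectors without extra coordinate see only the Laplacian error. Below, the
    unit vector of the extra coordinate sees only the number of edges, scaled by
    \<open>c\<^sup>2 = 2 * d / m\<close>.\<close>
  have "\<bar>(\<Sum>e\<in>E. (edge_vec e \<bullet> x)\<^sup>2) - s * (\<Sum>e\<in>F. (edge_vec e \<bullet> x)\<^sup>2)\<bar> \<le> 12 * sqrt (s * d) * (x \<bullet> x)" for x
    using bound[of "extend_vec x 0"] unfolding total sqrt16 w_def
    by (simp add: extend_vec_inner abs_minus_commute)
  moreover have "2 * d / m * \<bar>m - s * card F\<bar> \<le> 12 * sqrt (s * d)"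
  proof -
    have "\<bar>s * (c\<^sup>2 * card F) - c\<^sup>2 * m\<bar> \<le> 12 * sqrt (s * d)"
      using bound[of "extend_vec 0 1"] unfolding total sqrt16 w_def
      by (simp add: extend_vec_inner m_def mult.commute)
    moreover have "\<bar>s * (c\<^sup>2 * card F) - c\<^sup>2 * m\<bar> = c\<^sup>2 * \<bar>m - s * card F\<bar>"
    proof -
      have "s * (c\<^sup>2 * card F) - c\<^sup>2 * m = - (c\<^sup>2 * (m - s * card F))"
        by (simp add: algebra_simps)
      then show ?thesis
        by (simp only: abs_minus_cancel abs_mult abs_power2)
    qed
    ultimately show ?thesis
      by (simp only: c(1))
  qed
  ultimately show ?thesis
    using \<open>F \<subseteq> E\<close> by blast
qed

theorem theorem4p19:
  fixes E :: "'v::finite set set" and n m d :: nat and \<epsilon> m' :: real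
  assumes "simple_graph E"
    and "n = CARD('v)" and "m = card E" and "d = max_degree E"
    and "0 < \<epsilon>" and "\<epsilon> \<le> 1"
    and "m' = real n / \<epsilon>\<^sup>2"
    and "m' \<le> real m"
  shows "\<exists>F \<subseteq> E. real (card F) \<le> 8 * real n / \<epsilon>\<^sup>2 \<and>
    (- (8 * sqrt 2 * \<epsilon> * real d)) *\<^sub>R mat 1
      \<preceq> laplacian E - (real m / m') *\<^sub>R (\<Sum>e\<in>F. edge_matrix e) \<and>
    laplacian E - (real m / m') *\<^sub>R (\<Sum>e\<in>F. edge_matrix e)
      \<preceq> (8 * sqrt 2 * \<epsilon> * real d) *\<^sub>R mat 1"
proof -
  define s where "s = real m / m'"
  have "0 < real n"
    using assms(2) by simp
  then have "0 < m'"
    using assms(5,7) by simp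
  then have "1 \<le> s" "0 < real m"
    using assms(8) by (simp_all add: s_def)
  have m8: "8 * real n / \<epsilon>\<^sup>2 = 8 * m'"
    using assms(7) by simp
  have quad: "quad_form (laplacian E - s *\<^sub>R (\<Sum>e\<in>F. edge_matrix e)) x
      = (\<Sum>e\<in>E. (edge_vec e \<bullet> x)\<^sup>2) - s * (\<Sum>e\<in>F. (edge_vec e \<bullet> x)\<^sup>2)" for F x
    by (simp add: laplacian_def quad_form_diff quad_form_scaleR quad_form_sum edge_matrix_def quad_form_outer)
  have sym: "transpose (laplacian E - s *\<^sub>R (\<Sum>e\<in>F. edge_matrix e)) = laplacian E - s *\<^sub>R (\<Sum>e\<in>F. edge_matrix e)" for F
    by (simp add: laplacian_def edge_matrix_def outer_def transpose_def vec_eq_iff mult.commute)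
  show ?thesis
  proof (cases "s = 1")
    \<comment> \<open>Here \<open>1 / s\<close> is 1 and the random choice degenerates:
      \<open>F = E\<close> has error 0 and exactly \<open>m'\<close> edges.\<close>
    case True
    have "real (card E) \<le> 8 * real n / \<epsilon>\<^sup>2"
      using True \<open>0 < m'\<close> assms(3) m8 by (simp add: s_def)
    moreover have "\<bar>quad_form (laplacian E - s *\<^sub>R (\<Sum>e\<in>E. edge_matrix e)) x\<bar> \<le> 8 * sqrt 2 * \<epsilon> * real d * (x \<bullet> x)" for x
      unfolding quad using True assms(5) by simp
    ultimately show ?thesis
      using psd_le_bounds[OF sym] unfolding s_def[symmetric] by blast
  next
    case False
    then have s: "1 < s"
      using \<open>1 \<le> s\<close> by simp
    have "E \<noteq> {}"
      using \<open>0 < real m\<close> assms(3) by auto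
    from exists_edge_subset[OF assms(1) s this, folded assms(3,4)]
    obtain F where F: "F \<subseteq> E"
      "\<forall>x. \<bar>(\<Sum>e\<in>E. (edge_vec e \<bullet> x)\<^sup>2) - s * (\<Sum>e\<in>F. (edge_vec e \<bullet> x)\<^sup>2)\<bar> \<le> 12 * sqrt (s * d) * (x \<bullet> x)"
      "2 * real d / real m * \<bar>m - s * card F\<bar> \<le> 12 * sqrt (s * d)"
      by (elim exE conjE) (rule that)
    have md: "2 * real m \<le> real n * real d"
      using of_nat_mono[OF twice_card_edges_le[OF assms(1)], where 'a = real] by (simp add: assms(2-4))
    then have "0 < real d"
      using \<open>0 < real m\<close> by (smt (verit) mult_nonneg_nonpos of_nat_0_le_iff)
    \<comment> \<open>From \<open>2 * m \<le> n * d\<close> the sampling ratio is at most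
      \<open>d * \<epsilon>\<^sup>2 / 2\<close>, which replaces \<open>m\<close> and
      \<open>n\<close> in the error by \<open>d\<close> and \<epsilon>.\<close>
    have "s = real m * \<epsilon>\<^sup>2 / real n"
      by (simp add: s_def assms(7))
    also have "\<dots> \<le> (real n * real d / 2) * \<epsilon>\<^sup>2 / real n"
      using md by (intro divide_right_mono mult_right_mono) simp_all
    also have "\<dots> = real d * \<epsilon>\<^sup>2 / 2"
      using \<open>0 < real n\<close> by simp
    finally have "s * d \<le> (real d * \<epsilon>\<^sup>2 / 2) * d"
      by (rule mult_right_mono) simp
    also have "\<dots> = (sqrt 2 * \<epsilon> * d / 2)\<^sup>2"
      by (simp add: power_mult_distrib power_divide power2_eq_square)
    finally have "sqrt (s * d) \<le> sqrt 2 * \<epsilon> * d / 2"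
      using assms(5) by (intro real_le_lsqrt) simp_all
    then have root: "12 * sqrt (s * d) \<le> 6 * sqrt 2 * \<epsilon> * d"
      unfolding mult.assoc by linarith
    have "2 * real d / real m * (3 * sqrt 2 * \<epsilon> * m) = 6 * sqrt 2 * \<epsilon> * d"
      using \<open>0 < real m\<close> by (simp add: field_simps)
    then have "2 * real d / real m * \<bar>m - s * card F\<bar> \<le> 2 * real d / real m * (3 * sqrt 2 * \<epsilon> * m)"
      using F(3) root by linarith
    then have "\<bar>m - s * card F\<bar> \<le> 3 * sqrt 2 * \<epsilon> * m"
      using \<open>0 < real m\<close> \<open>0 < real d\<close> by (subst (asm) mult_le_cancel_left_pos) simp_all
    \<comment> \<open>The target \<open>s * card F \<le> 8 * m\<close> is
      \<open>card F \<le> 8 * m'\<close>, so a deviation of \<open>7 * m\<close> is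
      affordable.\<close>
    moreover have "3 * sqrt 2 * \<epsilon> * m \<le> 7 * real m"
    proof -
      have "sqrt 2 \<le> 7 / 3"
        by (rule real_le_lsqrt) (simp_all add: power2_eq_square)
      then have "sqrt 2 * \<epsilon> \<le> 7 / 3 * 1"
        using assms(5,6) by (intro mult_mono) auto
      then show ?thesis
        by (simp add: mult_right_mono)
    qed
    ultimately have "s * card F \<le> 8 * real m"
      by linarith
    then have "card F \<le> 8 * real n / \<epsilon>\<^sup>2"
      unfolding m8 using \<open>0 < m'\<close> \<open>0 < real m\<close> by (simp add: s_def field_simps)
    moreover have "\<bar>quad_form (laplacian E - s *\<^sub>R (\<Sum>e\<in>F. edge_matrix e)) x\<bar> \<le> 8 * sqrt 2 * \<epsilon> * real d * (x \<bullet> x)" for x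
    proof -
      have "12 * sqrt (s * d) \<le> 8 * sqrt 2 * \<epsilon> * d"
      proof -
        have "0 \<le> sqrt 2 * \<epsilon> * d"
          using assms(5) by simp
        then show ?thesis
          using root unfolding mult.assoc by linarith
      qed
      then have "12 * sqrt (s * d) * (x \<bullet> x) \<le> 8 * sqrt 2 * \<epsilon> * d * (x \<bullet> x)"
        by (intro mult_right_mono) simp_all
      with F(2)[rule_format, of x] show ?thesis
        unfolding quad by linarith
    qed
    ultimately show ?thesis
      using psd_le_bounds[OF sym] F(1) unfolding s_def[symmetric] by blast
  qed
qed

end
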